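(* Let $M$ be a smooth $d$-manifold and $\mathcal{A}=\{(U_i,E_i,D_i)\}_{i\in I}$ a smooth autoencoder atlas on $M$ with latent dimension $d$. If $\{(U_i,E_i)\}$ forms a smooth atlas compatible with the smooth structure of $M$, then $\mathcal{T}_{\mathcal{A}}\cong TM$ as vector bundles.
   Context: $M$ is compact, without boundary, embedded in $\mathbb{R}^N$. A smooth autoencoder chart on $M$ is a triple $(U,E,D)$ with $U\subset M$ open, $E:U\to Z\subset\mathbb{R}^d$ smooth and a diffeomorphism onto its image, $D:Z\to M$ smooth, and $D\circ E=\mathrm{Id}_U$; $d$ is the latent dimension. A smooth autoencoder atlas is a collection of such charts whose domains cover $M$. Transition maps are $T_{ji}=E_j\circ D_i:E_i(U_i\cap U_j)\to E_j(U_i\cap U_j)$; $g_{ji}(x)=d(T_{ji})_{E_i(x)}\in\mathrm{GL}_d(\mathbb{R})$ for $x\in U_i\cap U_j$. The tangent bundle of the atlas is $\mathcal{T}_{\mathcal{A}}=\bigl(\bigsqcup_i U_i\times\mathbb{R}^d\bigr)/\sim$ with $(x,v)_i\sim(x,g_{ji}(x)v)_j$ for $x\in U_i\cap U_j$, $v\in\mathbb{R}^d$. *)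

theory Defs
  imports "HOL-Analysis.Analysis"
begin

section \<open>Smooth maps between subsets of normed spaces\<close>

text \<open>\<open>Ck_on k S f\<close> is meaningful for open \<open>S\<close>: all iterated directional derivatives of \<open>f\<close>
  up to order \<open>k\<close> exist and are continuous on \<open>S\<close>.\<close>

primrec Ck_on ::
  "nat \<Rightarrow> 'a::real_normed_vector set \<Rightarrow> ('a \<Rightarrow> 'b::real_normed_vector) \<Rightarrow> bool" where
  "Ck_on 0 S f \<longleftrightarrow> continuous_on S f"
| "Ck_on (Suc k) S f \<longleftrightarrow>
     (\<forall>x\<in>S. f differentiable (at x)) \<and> (\<forall>v. Ck_on k S (\<lambda>x. frechet_derivative f (at x) v))"

text \<open>A map on an arbitrary subset is smooth if locally it is the restriction of a smooth map
  defined on an open set of the ambient space. On an embedded submanifold this is smoothness with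
  respect to the induced smooth structure. Values of \<open>f\<close> outside \<open>S\<close> are irrelevant.\<close>

definition smooth_on ::
  "'a::real_normed_vector set \<Rightarrow> ('a \<Rightarrow> 'b::real_normed_vector) \<Rightarrow> bool" where
  "smooth_on S f \<longleftrightarrow>
     (\<forall>x\<in>S. \<exists>V h. open V \<and> x \<in> V \<and> (\<forall>k. Ck_on k V h) \<and> (\<forall>y\<in>S \<inter> V. h y = f y))"

definition diffeomorphism_on ::
  "'a::real_normed_vector set \<Rightarrow> 'b::real_normed_vector set \<Rightarrow> ('a \<Rightarrow> 'b) \<Rightarrow> bool" where
  "diffeomorphism_on S T f \<longleftrightarrow> bij_betw f S T \<and> smooth_on S f \<and> smooth_on T (inv_into S f)"


section \<open>Embedded submanifolds, charts and atlases\<close>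

text \<open>A chart is a pair \<open>(U, \<phi>)\<close> with \<open>U \<subseteq> M\<close> open in \<open>M\<close> and \<open>\<phi>\<close> used on \<open>U\<close> only.
  The smooth structure that \<open>M\<close> inherits from the ambient space is given as the set of all
  its charts; the model space is the type \<open>'b\<close>.\<close>

definition smooth_structure ::
  "'a::euclidean_space set \<Rightarrow> ('a set \<times> ('a \<Rightarrow> 'b::euclidean_space)) set" where
  "smooth_structure M =
     {(U, \<phi>). openin (top_of_set M) U \<and> open (\<phi> ` U) \<and> diffeomorphism_on U (\<phi> ` U) \<phi>}"

text \<open>\<open>M\<close> is an embedded smooth submanifold without boundary, of dimension \<open>DIM('b)\<close>.\<close>

definition smooth_submanifold :: "'b::euclidean_space itself \<Rightarrow> 'a::euclidean_space set \<Rightarrow> bool" where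
  "smooth_submanifold _ M \<longleftrightarrow>
     (\<forall>x\<in>M. \<exists>(U, \<phi>) \<in> (smooth_structure M :: ('a set \<times> ('a \<Rightarrow> 'b)) set). x \<in> U)"

definition transition ::
  "'a set \<times> ('a \<Rightarrow> 'b) \<Rightarrow> 'a set \<times> ('a \<Rightarrow> 'b) \<Rightarrow> 'b \<Rightarrow> 'b" where
  "transition c c' = snd c' \<circ> inv_into (fst c) (snd c)"

definition smoothly_compatible ::
  "'a set \<times> ('a \<Rightarrow> 'b::real_normed_vector) \<Rightarrow> 'a set \<times> ('a \<Rightarrow> 'b) \<Rightarrow> bool" where
  "smoothly_compatible c c' \<longleftrightarrow>
     smooth_on (snd c ` (fst c \<inter> fst c')) (transition c c') \<and>
     smooth_on (snd c' ` (fst c \<inter> fst c')) (transition c' c)"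

definition smooth_atlas ::
  "'a::euclidean_space set \<Rightarrow> ('a set \<times> ('a \<Rightarrow> 'b::euclidean_space)) set \<Rightarrow> bool" where
  "smooth_atlas M C \<longleftrightarrow>
     (\<forall>(U, \<phi>)\<in>C. openin (top_of_set M) U \<and> open (\<phi> ` U) \<and>
        homeomorphism U (\<phi> ` U) \<phi> (inv_into U \<phi>)) \<and>
     (\<Union>(U, \<phi>)\<in>C. U) = M \<and>
     (\<forall>c\<in>C. \<forall>c'\<in>C. smoothly_compatible c c')"

definition compatible_with_smooth_structure ::
  "'a::euclidean_space set \<Rightarrow> ('a set \<times> ('a \<Rightarrow> 'b::euclidean_space)) set \<Rightarrow> bool" where
  "compatible_with_smooth_structure M C \<longleftrightarrow>
     (\<forall>c\<in>C. \<forall>c'\<in>smooth_structure M. smoothly_compatible c c')"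


section \<open>Smooth autoencoder atlases\<close>

text \<open>The latent set \<open>Z\<close>, the domain of the decoder, is kept as part of the data because HOL
  functions are total. It is an arbitrary subset of the latent space.\<close>

record ('a, 'b) ae_chart =
  ae_dom :: "'a set"
  ae_latent :: "'b set"
  ae_enc :: "'a \<Rightarrow> 'b"
  ae_dec :: "'b \<Rightarrow> 'a"

definition smooth_ae_chart ::
  "'a::euclidean_space set \<Rightarrow> ('a, 'b::euclidean_space) ae_chart \<Rightarrow> bool" where
  "smooth_ae_chart M c \<longleftrightarrow>
     openin (top_of_set M) (ae_dom c) \<and>
     ae_enc c ` ae_dom c \<subseteq> ae_latent c \<and>
     smooth_on (ae_dom c) (ae_enc c) \<and>
     diffeomorphism_on (ae_dom c) (ae_enc c ` ae_dom c) (ae_enc c) \<and>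
     ae_dec c ` ae_latent c \<subseteq> M \<and>
     smooth_on (ae_latent c) (ae_dec c) \<and>
     (\<forall>x\<in>ae_dom c. ae_dec c (ae_enc c x) = x)"

definition smooth_ae_atlas ::
  "'a::euclidean_space set \<Rightarrow> 'i set \<Rightarrow> ('i \<Rightarrow> ('a, 'b::euclidean_space) ae_chart) \<Rightarrow> bool" where
  "smooth_ae_atlas M I A \<longleftrightarrow>
     (\<forall>i\<in>I. smooth_ae_chart M (A i)) \<and> (\<Union>i\<in>I. ae_dom (A i)) = M"

text \<open>\<open>ae_transition A j i\<close> is $T_{ji}$ and \<open>ae_cocycle A j i x\<close> is $g_{ji}(x)$. The derivative is
  taken within the domain of $T_{ji}$, which is open whenever the encoders are charts.\<close>

definition ae_transition :: "('i \<Rightarrow> ('a, 'b) ae_chart) \<Rightarrow> 'i \<Rightarrow> 'i \<Rightarrow> 'b \<Rightarrow> 'b" where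
  "ae_transition A j i = ae_enc (A j) \<circ> ae_dec (A i)"

definition ae_cocycle ::
  "('i \<Rightarrow> ('a, 'b::real_normed_vector) ae_chart) \<Rightarrow> 'i \<Rightarrow> 'i \<Rightarrow> 'a \<Rightarrow> 'b \<Rightarrow> 'b" where
  "ae_cocycle A j i x =
     frechet_derivative (ae_transition A j i)
       (at (ae_enc (A i) x) within ae_enc (A i) ` (ae_dom (A i) \<inter> ae_dom (A j)))"


section \<open>Smooth vector bundles\<close>

text \<open>A bundle over a subset of \<open>'a\<close> with total space in \<open>'e\<close> and typical fibre \<open>'b\<close>. Addition and
  scaling are only meaningful within fibres. A trivialization is a pair \<open>(U, \<tau>)\<close>, where \<open>\<tau>\<close> is the
  fibre component: the actual trivializing map is \<open>e \<mapsto> (\<pi> e, \<tau> e)\<close> from the \<open>\<pi>\<close>-preimage of \<open>U\<close>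
  to \<open>U \<times> 'b\<close>.\<close>

record ('e, 'a, 'b) vbundle =
  b_total :: "'e topology"
  b_proj :: "'e \<Rightarrow> 'a"
  b_add :: "'e \<Rightarrow> 'e \<Rightarrow> 'e"
  b_scale :: "real \<Rightarrow> 'e \<Rightarrow> 'e"
  b_trivs :: "('a set \<times> ('e \<Rightarrow> 'b)) set"

definition b_over :: "('e, 'a, 'b) vbundle \<Rightarrow> 'a set \<Rightarrow> 'e set" where
  "b_over B U = {e \<in> topspace (b_total B). b_proj B e \<in> U}"

definition triv_map :: "('e, 'a, 'b) vbundle \<Rightarrow> 'a set \<times> ('e \<Rightarrow> 'b) \<Rightarrow> 'e \<Rightarrow> 'a \<times> 'b" where
  "triv_map B t e = (b_proj B e, snd t e)"

definition triv_inv :: "('e, 'a, 'b) vbundle \<Rightarrow> 'a set \<times> ('e \<Rightarrow> 'b) \<Rightarrow> 'a \<times> 'b \<Rightarrow> 'e" where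
  "triv_inv B t = inv_into (b_over B (fst t)) (triv_map B t)"

text \<open>The fibres need no separate vector space axioms: each fibre is closed under the operations
  and a trivialization maps it bijectively onto \<open>'b\<close>, carrying the operations of the
  fibre to those of \<open>'b\<close>.\<close>

definition smooth_vector_bundle ::
  "'a::euclidean_space set \<Rightarrow> ('e, 'a, 'b::euclidean_space) vbundle \<Rightarrow> bool" where
  "smooth_vector_bundle M B \<longleftrightarrow>
     continuous_map (b_total B) (top_of_set M) (b_proj B) \<and>
     (\<forall>x\<in>M. \<forall>e\<in>b_over B {x}. \<forall>e'\<in>b_over B {x}. b_add B e e' \<in> b_over B {x}) \<and>
     (\<forall>x\<in>M. \<forall>e\<in>b_over B {x}. \<forall>r. b_scale B r e \<in> b_over B {x}) \<and>
     (\<Union>t\<in>b_trivs B. fst t) = M \<and>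
     (\<forall>t\<in>b_trivs B.
        openin (top_of_set M) (fst t) \<and>
        homeomorphic_map (subtopology (b_total B) (b_over B (fst t)))
          (top_of_set (fst t \<times> UNIV)) (triv_map B t) \<and>
        (\<forall>x\<in>fst t. \<forall>e\<in>b_over B {x}.
           (\<forall>e'\<in>b_over B {x}. snd t (b_add B e e') = snd t e + snd t e') \<and>
           (\<forall>r. snd t (b_scale B r e) = r *\<^sub>R snd t e))) \<and>
     (\<forall>t\<in>b_trivs B. \<forall>t'\<in>b_trivs B.
        smooth_on ((fst t \<inter> fst t') \<times> UNIV) (\<lambda>p. snd t' (triv_inv B t p)))"

text \<open>Smooth bundle maps over the identity of \<open>M\<close>; smoothness is read off in trivializations.\<close>

definition bundle_hom ::
  "'a::euclidean_space set \<Rightarrow> ('e, 'a, 'b::euclidean_space) vbundle \<Rightarrow>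
     ('f, 'a, 'c::euclidean_space) vbundle \<Rightarrow> ('e \<Rightarrow> 'f) \<Rightarrow> bool" where
  "bundle_hom M B B' F \<longleftrightarrow>
     continuous_map (b_total B) (b_total B') F \<and>
     (\<forall>e\<in>topspace (b_total B). b_proj B' (F e) = b_proj B e) \<and>
     (\<forall>x\<in>M. \<forall>e\<in>b_over B {x}.
        (\<forall>e'\<in>b_over B {x}. F (b_add B e e') = b_add B' (F e) (F e')) \<and>
        (\<forall>r. F (b_scale B r e) = b_scale B' r (F e))) \<and>
     (\<forall>t\<in>b_trivs B. \<forall>t'\<in>b_trivs B'.
        smooth_on ((fst t \<inter> fst t') \<times> UNIV) (\<lambda>p. snd t' (F (triv_inv B t p))))"

definition isomorphic_vector_bundles ::
  "'a::euclidean_space set \<Rightarrow> ('e, 'a, 'b::euclidean_space) vbundle \<Rightarrow>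
     ('f, 'a, 'c::euclidean_space) vbundle \<Rightarrow> bool" where
  "isomorphic_vector_bundles M B B' \<longleftrightarrow>
     smooth_vector_bundle M B \<and> smooth_vector_bundle M B' \<and>
     (\<exists>F G. bundle_hom M B B' F \<and> bundle_hom M B' B G \<and>
        (\<forall>e\<in>topspace (b_total B). G (F e) = e) \<and>
        (\<forall>e\<in>topspace (b_total B'). F (G e) = e))"


section \<open>The tangent bundle of an embedded submanifold\<close>

definition smooth_curve ::
  "'a::euclidean_space set \<Rightarrow> 'a \<Rightarrow> 'a \<Rightarrow> (real \<Rightarrow> 'a) \<Rightarrow> bool" where
  "smooth_curve M x v \<gamma> \<longleftrightarrow>
     (\<exists>\<epsilon>>0. smooth_on {-\<epsilon><..<\<epsilon>} \<gamma> \<and> \<gamma> ` {-\<epsilon><..<\<epsilon>} \<subseteq> M) \<and>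
     \<gamma> 0 = x \<and> (\<gamma> has_vector_derivative v) (at 0)"

definition tangent_space :: "'a::euclidean_space set \<Rightarrow> 'a \<Rightarrow> 'a set" where
  "tangent_space M x = {v. \<exists>\<gamma>. smooth_curve M x v \<gamma>}"

text \<open>The differential at \<open>x\<close> of a map \<open>f\<close> that is smooth on the submanifold \<open>U\<close>, applied to a
  tangent vector \<open>v\<close>: the velocity of \<open>f \<circ> \<gamma>\<close> for the curves \<open>\<gamma>\<close> representing \<open>v\<close>.\<close>

definition tangent_map ::
  "'a::euclidean_space set \<Rightarrow> ('a \<Rightarrow> 'b::euclidean_space) \<Rightarrow> 'a \<Rightarrow> 'a \<Rightarrow> 'b" where
  "tangent_map U f x v =
     (THE w. \<forall>\<gamma>. smooth_curve U x v \<gamma> \<longrightarrow> ((f \<circ> \<gamma>) has_vector_derivative w) (at 0))"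

definition tangent_bundle ::
  "'a::euclidean_space set \<Rightarrow> ('a \<times> 'a, 'a, 'b::euclidean_space) vbundle" where
  "tangent_bundle M =
     \<lparr> b_total = top_of_set (Sigma M (tangent_space M)),
       b_proj = fst,
       b_add = (\<lambda>e e'. (fst e, snd e + snd e')),
       b_scale = (\<lambda>r e. (fst e, r *\<^sub>R snd e)),
       b_trivs = (\<lambda>(U, \<phi>). (U, \<lambda>(x, v). tangent_map U \<phi> x v)) ` smooth_structure M \<rparr>"


section \<open>The tangent bundle of an autoencoder atlas\<close>

definition quotient_topology :: "'p topology \<Rightarrow> ('p \<Rightarrow> 'q) \<Rightarrow> 'q topology" where
  "quotient_topology X q =
     topology (\<lambda>S. S \<subseteq> q ` topspace X \<and> openin X {p \<in> topspace X. q p \<in> S})"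

lemma istopology_quotient:
  "istopology (\<lambda>S. S \<subseteq> q ` topspace X \<and> openin X {p \<in> topspace X. q p \<in> S})"
proof -
  have int: "{p \<in> topspace X. q p \<in> S \<inter> T} =
      {p \<in> topspace X. q p \<in> S} \<inter> {p \<in> topspace X. q p \<in> T}" for S T
    by blast
  have un: "{p \<in> topspace X. q p \<in> \<Union>K} = (\<Union>S\<in>K. {p \<in> topspace X. q p \<in> S})" for K
    by blast
  show ?thesis
    unfolding istopology_def int un by (auto intro!: openin_Union)
qed

lemma openin_quotient_topology:
  "openin (quotient_topology X q) S \<longleftrightarrow>
     S \<subseteq> q ` topspace X \<and> openin X {p \<in> topspace X. q p \<in> S}"
  unfolding quotient_topology_def topology_inverse'[OF istopology_quotient] ..

text \<open>\<open>(i, x, v)\<close> stands for $(x,v)_i$.\<close>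

definition ae_glue ::
  "'i set \<Rightarrow> ('i \<Rightarrow> ('a, 'b::real_normed_vector) ae_chart) \<Rightarrow> (('i \<times> 'a \<times> 'b) \<times> ('i \<times> 'a \<times> 'b)) set" where
  "ae_glue I A =
     {((i, x, v), (j, x, ae_cocycle A j i x v)) | i j x v.
        i \<in> I \<and> j \<in> I \<and> x \<in> ae_dom (A i) \<inter> ae_dom (A j)}"

text \<open>Points of the total space are equivalence classes. Since a class over \<open>x\<close> has one
  representative for every \<open>i\<close> with \<open>x\<close> in the \<open>i\<close>-th domain, the representativewise sum below is
  again a full class.\<close>

definition ae_tangent_bundle ::
  "'i set \<Rightarrow> ('i \<Rightarrow> ('a::euclidean_space, 'b::euclidean_space) ae_chart) \<Rightarrow>
     (('i \<times> 'a \<times> 'b) set, 'a, 'b) vbundle" where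
  "ae_tangent_bundle I A =
     \<lparr> b_total = quotient_topology
         (sum_topology (\<lambda>i. prod_topology (top_of_set (ae_dom (A i))) euclidean) I)
         (\<lambda>p. ae_glue I A `` {p}),
       b_proj = (\<lambda>C. THE x. \<exists>i v. (i, x, v) \<in> C),
       b_add = (\<lambda>C C'. {(i, x, v + w) | i x v w. (i, x, v) \<in> C \<and> (i, x, w) \<in> C'}),
       b_scale = (\<lambda>r C. {(i, x, r *\<^sub>R v) | i x v. (i, x, v) \<in> C}),
       b_trivs = (\<lambda>i. (ae_dom (A i), \<lambda>C. THE v. \<exists>x. (i, x, v) \<in> C)) ` I \<rparr>"

end

theory Submission
  imports Defs
begin

text \<open>The encoders are charts of the smooth structure, so for \<open>x\<close> in the \<open>i\<close>-th domain the
  differential of the \<open>i\<close>-th encoder is a linear isomorphism from the tangent space at \<open>x\<close> onto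
  the latent space, whose inverse is the derivative of the inverse chart at the code of \<open>x\<close>. Since
  the \<open>i\<close>-th decoder agrees with the inverse chart on codes, the chain rule gives
  $g_{ji}(x) = d(E_j)_x \circ d(E_i)_x^{-1}$. Hence the class of \<open>(i, x, w)\<close> consists of the
  coordinates, in all encoders around \<open>x\<close>, of the single tangent vector $d(E_i)_x^{-1} w$, and
  sending a tangent vector to its class is a bijection. It is a homeomorphism because
  $(x, w)_i \mapsto (x, d(E_i)_x^{-1} w)$ is an open continuous surjection from the disjoint union,
  hence a quotient map with the same fibres as the gluing. It matches the trivializations given by
  \<open>E_i\<close>, so the bundle structure and its smoothness are transported from the tangent bundle.\<close>

section \<open>Calculus of smooth maps\<close>

lemma Ck_on_subset: "Ck_on k S f \<Longrightarrow> T \<subseteq> S \<Longrightarrow> Ck_on k T f"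
  by (induction k arbitrary: f) (auto intro: continuous_on_subset)

lemma frechet_derivative_cong_open:
  assumes "open S" "x \<in> S" "\<And>y. y \<in> S \<Longrightarrow> f y = g y"
  shows "frechet_derivative f (at x) = frechet_derivative g (at x)"
proof -
  have "(f has_derivative f') (at x) \<longleftrightarrow> (g has_derivative f') (at x)" for f'
    using assms has_derivative_transform_within_open[OF _ assms(1,2), of f f' UNIV g]
      has_derivative_transform_within_open[OF _ assms(1,2), of g f' UNIV f] by auto
  then show ?thesis
    by (simp add: frechet_derivative_def)
qed

lemma differentiable_cong_open:
  assumes "open S" "x \<in> S" "\<And>y. y \<in> S \<Longrightarrow> f y = g y" "f differentiable (at x)"
  shows "g differentiable (at x)"
  using assms has_derivative_transform_within_open[OF _ assms(1,2), of f _ UNIV g]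
  unfolding differentiable_def by metis

lemma Ck_on_cong:
  assumes "open S" "\<And>x. x \<in> S \<Longrightarrow> f x = g x" "Ck_on k S f"
  shows "Ck_on k S g"
  using assms(2,3)
proof (induction k arbitrary: f g)
  case 0
  then show ?case by (simp cong: continuous_on_cong)
next
  case (Suc k)
  have "Ck_on k S (\<lambda>x. frechet_derivative g (at x) v)" for v
  proof (rule Suc.IH[of "\<lambda>x. frechet_derivative f (at x) v"])
    show "frechet_derivative f (at x) v = frechet_derivative g (at x) v" if "x \<in> S" for x
      using frechet_derivative_cong_open[OF assms(1) that Suc.prems(1)] by simp
  qed (use Suc.prems in auto)
  moreover have "g differentiable (at x)" if "x \<in> S" for x
    using differentiable_cong_open[OF assms(1) that Suc.prems(1)] Suc.prems(2) that by simp
  ultimately show ?case by simp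
qed

lemma Ck_on_SucD: "Ck_on (Suc k) S f \<Longrightarrow> Ck_on k S f"
proof (induction k arbitrary: f)
  case 0
  then show ?case
    by (auto intro!: continuous_at_imp_continuous_on differentiable_imp_continuous_within)
next
  case (Suc k)
  have "Ck_on k S (\<lambda>x. frechet_derivative f (at x) v)" for v
    by (rule Suc.IH) (use Suc.prems in simp)
  with Suc.prems show ?case by simp
qed

text \<open>By uniqueness of derivatives, any explicit formula \<open>f'\<close> may stand in for
  \<open>frechet_derivative\<close>. The closure lemmas below thereby become differentiation rules
  followed by the induction hypothesis.\<close>

lemma Ck_on_SucI:
  assumes "open S" "\<And>x. x \<in> S \<Longrightarrow> (f has_derivative f' x) (at x)"
    and "\<And>v. Ck_on k S (\<lambda>x. f' x v)"
  shows "Ck_on (Suc k) S f"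
proof -
  have "Ck_on k S (\<lambda>x. frechet_derivative f (at x) v)" for v
    by (rule Ck_on_cong[OF assms(1) _ assms(3)])
      (simp add: frechet_derivative_at[OF assms(2), symmetric])
  then show ?thesis
    using assms(2) by (auto simp: differentiable_def)
qed

lemma Ck_on_Suc_has_derivative:
  "Ck_on (Suc k) S f \<Longrightarrow> x \<in> S \<Longrightarrow> (f has_derivative frechet_derivative f (at x)) (at x)"
  by (simp add: frechet_derivative_works)

text \<open>Every level of \<open>Ck_on\<close> is a condition at single points, so a neighbourhood
  that works for \<open>f\<close> also works for its directional derivatives in the
  induction.\<close>

lemma Ck_on_local:
  assumes "\<And>x. x \<in> S \<Longrightarrow> \<exists>V. open V \<and> x \<in> V \<and> Ck_on k V f"
  shows "Ck_on k S f"
  using assms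
proof (induction k arbitrary: f)
  case 0
  have "isCont f x" if "x \<in> S" for x
    using 0[OF that] continuous_on_eq_continuous_at by auto
  then show ?case
    by (auto intro: continuous_at_imp_continuous_on)
next
  case (Suc k)
  have "Ck_on k S (\<lambda>x. frechet_derivative f (at x) v)" for v
  proof (rule Suc.IH)
    fix x assume "x \<in> S"
    from Suc.prems[OF this]
    show "\<exists>V. open V \<and> x \<in> V \<and> Ck_on k V (\<lambda>x. frechet_derivative f (at x) v)"
      by auto
  qed
  moreover have "f differentiable (at x)" if "x \<in> S" for x
    using Suc.prems[OF that] by auto
  ultimately show ?case by simp
qed

lemma Ck_on_const: "open S \<Longrightarrow> Ck_on k S (\<lambda>_. c)"
proof (induction k arbitrary: c)
  case (Suc k)
  show ?case
    by (rule Ck_on_SucI[where f' = "\<lambda>_ _. 0"]) (use Suc in auto)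
qed simp

lemma Ck_on_bounded_linear:
  assumes "bounded_linear L" "open S"
  shows "Ck_on k S f \<Longrightarrow> Ck_on k S (\<lambda>x. L (f x))"
proof (induction k arbitrary: f)
  case 0
  then show ?case
    using bounded_linear.continuous_on[OF assms(1)] by auto
next
  case (Suc k)
  show ?case
  proof (rule Ck_on_SucI[OF assms(2)])
    show "((\<lambda>x. L (f x)) has_derivative (\<lambda>v. L (frechet_derivative f (at x) v))) (at x)"
      if "x \<in> S" for x
      using bounded_linear.has_derivative[OF assms(1)] Ck_on_Suc_has_derivative[OF Suc.prems that]
      by blast
  qed (use Suc in auto)
qed

lemma Ck_on_id: "open S \<Longrightarrow> Ck_on k S (\<lambda>x. x)"
proof (cases k)
  case (Suc n)
  assume "open S"
  then show ?thesis
    unfolding Suc by (intro Ck_on_SucI[where f' = "\<lambda>_ v. v"] Ck_on_const) auto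
qed simp

lemma Ck_on_add:
  "open S \<Longrightarrow> Ck_on k S f \<Longrightarrow> Ck_on k S g \<Longrightarrow> Ck_on k S (\<lambda>x. f x + g x)"
proof (induction k arbitrary: f g)
  case 0
  then show ?case by (simp add: continuous_on_add)
next
  case (Suc k)
  show ?case
  proof (rule Ck_on_SucI[OF Suc.prems(1)])
    show "((\<lambda>x. f x + g x) has_derivative
        (\<lambda>v. frechet_derivative f (at x) v + frechet_derivative g (at x) v)) (at x)"
      if "x \<in> S" for x
      by (intro has_derivative_add Ck_on_Suc_has_derivative[OF Suc.prems(2) that]
        Ck_on_Suc_has_derivative[OF Suc.prems(3) that])
  qed (use Suc in auto)
qed

lemma Ck_on_sum:
  "open S \<Longrightarrow> (\<And>b. b \<in> B \<Longrightarrow> Ck_on k S (f b)) \<Longrightarrow> Ck_on k S (\<lambda>x. \<Sum>b\<in>B. f b x)"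
  by (induction B rule: infinite_finite_induct) (auto intro: Ck_on_const Ck_on_add)

lemma Ck_on_scaleR:
  fixes f :: "'a::real_normed_vector \<Rightarrow> real"
  shows "open S \<Longrightarrow> Ck_on k S f \<Longrightarrow> Ck_on k S g \<Longrightarrow> Ck_on k S (\<lambda>x. f x *\<^sub>R g x)"
proof (induction k arbitrary: f g)
  case 0
  then show ?case by (simp add: continuous_on_scaleR)
next
  case (Suc k)
  show ?case
  proof (rule Ck_on_SucI[OF Suc.prems(1)])
    show "((\<lambda>x. f x *\<^sub>R g x) has_derivative
        (\<lambda>v. f x *\<^sub>R frechet_derivative g (at x) v + frechet_derivative f (at x) v *\<^sub>R g x)) (at x)"
      if "x \<in> S" for x
      by (intro has_derivative_scaleR Ck_on_Suc_has_derivative[OF Suc.prems(2) that]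
        Ck_on_Suc_has_derivative[OF Suc.prems(3) that])
    show "Ck_on k S (\<lambda>x. f x *\<^sub>R frechet_derivative g (at x) v + frechet_derivative f (at x) v *\<^sub>R g x)" for v
      \<comment> \<open>Each summand of the product rule keeps one factor undifferentiated, so the
        induction hypothesis needs \<open>f\<close> and \<open>g\<close> themselves at order
        \<open>k\<close> too.\<close>
      using Suc.prems Ck_on_SucD[OF Suc.prems(2)] Ck_on_SucD[OF Suc.prems(3)]
      by (intro Ck_on_add Suc.IH) auto
  qed
qed

lemma Ck_on_Pair:
  "open S \<Longrightarrow> Ck_on k S f \<Longrightarrow> Ck_on k S g \<Longrightarrow> Ck_on k S (\<lambda>x. (f x, g x))"
proof (induction k arbitrary: f g)
  case 0
  then show ?case by (simp add: continuous_on_Pair)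
next
  case (Suc k)
  show ?case
  proof (rule Ck_on_SucI[OF Suc.prems(1)])
    show "((\<lambda>x. (f x, g x)) has_derivative
        (\<lambda>v. (frechet_derivative f (at x) v, frechet_derivative g (at x) v))) (at x)"
      if "x \<in> S" for x
      by (intro has_derivative_Pair Ck_on_Suc_has_derivative[OF Suc.prems(2) that]
        Ck_on_Suc_has_derivative[OF Suc.prems(3) that])
  qed (use Suc in auto)
qed

lemma linear_euclidean_expand:
  fixes L :: "'a::euclidean_space \<Rightarrow> 'b::real_vector"
  assumes "linear L"
  shows "L v = (\<Sum>b\<in>Basis. (v \<bullet> b) *\<^sub>R L b)"
proof -
  have "L v = L (\<Sum>b\<in>Basis. (v \<bullet> b) *\<^sub>R b)"
    by (simp add: euclidean_representation)
  then show ?thesis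
    by (simp add: linear_sum[OF assms] linear_scale[OF assms])
qed

text \<open>\<open>Ck_on\<close> speaks of derivatives in a fixed direction, but the chain rule
  applies the derivative of \<open>g\<close> to the moving vector \<open>?f' x v\<close>. Expanding
  that vector over \<open>Basis\<close> of the intermediate space gives scalar coefficients times
  composites of \<open>f\<close> with derivatives of \<open>g\<close> in fixed directions
  \<open>b\<close>, and the induction hypothesis covers those composites.\<close>

lemma Ck_on_compose:
  fixes f :: "'a::real_normed_vector \<Rightarrow> 'b::euclidean_space"
  shows "open S \<Longrightarrow> open T \<Longrightarrow> f ` S \<subseteq> T \<Longrightarrow> Ck_on k S f \<Longrightarrow> Ck_on k T g \<Longrightarrow>
    Ck_on k S (\<lambda>x. g (f x))"
proof (induction k arbitrary: g)
  case 0
  then show ?case by (auto intro: continuous_on_compose2)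
next
  case (Suc k)
  let ?f' = "\<lambda>x. frechet_derivative f (at x)" and ?g' = "\<lambda>y. frechet_derivative g (at y)"
  show ?case
  proof (rule Ck_on_SucI[OF Suc.prems(1)])
    fix x assume x: "x \<in> S"
    then have fx: "f x \<in> T"
      using Suc.prems by auto
    have g: "(g has_derivative ?g' (f x)) (at (f x))"
      by (rule Ck_on_Suc_has_derivative[OF Suc.prems(5) fx])
    have eq: "?g' (f x) (?f' x v) = (\<Sum>b\<in>Basis. (?f' x v \<bullet> b) *\<^sub>R ?g' (f x) b)" for v
      using linear_euclidean_expand[OF has_derivative_linear[OF g]] .
    show "((\<lambda>x. g (f x)) has_derivative (\<lambda>v. \<Sum>b\<in>Basis. (?f' x v \<bullet> b) *\<^sub>R ?g' (f x) b)) (at x)"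
      using has_derivative_compose[OF Ck_on_Suc_has_derivative[OF Suc.prems(4) x] g]
      unfolding eq .
  next
    fix v
    have "Ck_on k S f"
      using Suc.prems Ck_on_SucD by blast
    then show "Ck_on k S (\<lambda>x. \<Sum>b\<in>Basis. (?f' x v \<bullet> b) *\<^sub>R ?g' (f x) b)"
      using Suc.prems
      by (intro Ck_on_sum Ck_on_scaleR Suc.IH Ck_on_bounded_linear[OF bounded_linear_inner_left]) auto
  qed
qed

text \<open>Joint regularity in base point and direction, at the cost of one order: linearity in the
  direction reduces it to finitely many fixed directions. This is what later makes differentials
  smooth on total spaces.\<close>

lemma Ck_on_derivative:
  fixes f :: "'a::euclidean_space \<Rightarrow> 'b::real_normed_vector"
  assumes "open S" "Ck_on (Suc k) S f"
  shows "Ck_on k (S \<times> UNIV) (\<lambda>p. frechet_derivative f (at (fst p)) (snd p))"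
proof -
  have o: "open (S \<times> (UNIV :: 'a set))"
    using assms(1) by (simp add: open_Times)
  have "Ck_on k (S \<times> UNIV) (\<lambda>p. \<Sum>b\<in>Basis. (snd p \<bullet> b) *\<^sub>R frechet_derivative f (at (fst p)) b)"
  proof (intro Ck_on_sum Ck_on_scaleR o)
    fix b :: 'a
    show "Ck_on k (S \<times> UNIV) (\<lambda>p. snd p \<bullet> b)"
      by (intro Ck_on_bounded_linear[OF bounded_linear_inner_left]
        Ck_on_bounded_linear[OF bounded_linear_snd] Ck_on_id o)
    show "Ck_on k (S \<times> (UNIV :: 'a set)) (\<lambda>p. frechet_derivative f (at (fst p)) b)"
      by (rule Ck_on_compose[OF o assms(1), of fst])
        (use assms in \<open>auto intro!: Ck_on_bounded_linear[OF bounded_linear_fst o] Ck_on_id o\<close>)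
  qed
  then show ?thesis
  proof (rule Ck_on_cong[OF o, rotated])
    fix p :: "'a \<times> 'a" assume "p \<in> S \<times> UNIV"
    then have "fst p \<in> S" by auto
    from linear_euclidean_expand[OF has_derivative_linear[OF Ck_on_Suc_has_derivative[OF assms(2) this]]]
    show "(\<Sum>b\<in>Basis. (snd p \<bullet> b) *\<^sub>R frechet_derivative f (at (fst p)) b) =
        frechet_derivative f (at (fst p)) (snd p)" ..
  qed
qed

section \<open>Smoothness on arbitrary subsets through local extensions\<close>

lemma smooth_onE:
  assumes "smooth_on S f" "x \<in> S"
  obtains V h where "open V" "x \<in> V" "\<And>k. Ck_on k V h" "\<And>y. y \<in> S \<inter> V \<Longrightarrow> h y = f y"
proof -
  have "\<exists>V h. open V \<and> x \<in> V \<and> (\<forall>k. Ck_on k V h) \<and> (\<forall>y\<in>S \<inter> V. h y = f y)"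
    using assms unfolding smooth_on_def by (rule bspec)
  then show thesis
    using that by metis
qed

lemma smooth_onI:
  assumes "\<And>x. x \<in> S \<Longrightarrow> \<exists>V h. open V \<and> x \<in> V \<and> (\<forall>k. Ck_on k V h) \<and> (\<forall>y\<in>S \<inter> V. h y = f y)"
  shows "smooth_on S f"
  unfolding smooth_on_def using assms by (rule ballI)

text \<open>An extension coincides with \<open>f\<close> on the open set
  \<open>S \<inter> V\<close>, so by locality the regularity of the extensions passes to
  \<open>f\<close>; conversely \<open>f\<close> extends itself.\<close>

lemma smooth_on_open_iff:
  assumes "open S"
  shows "smooth_on S f \<longleftrightarrow> (\<forall>k. Ck_on k S f)"
proof
  assume f: "smooth_on S f"
  have "Ck_on k S f" for k
  proof (rule Ck_on_local)
    fix x assume "x \<in> S"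
    with f obtain V h where V: "open V" "x \<in> V" "Ck_on k V h" "\<And>y. y \<in> S \<inter> V \<Longrightarrow> h y = f y"
      unfolding smooth_on_def by metis
    have "Ck_on k (S \<inter> V) f"
      by (rule Ck_on_cong[OF _ V(4) Ck_on_subset[OF V(3)]]) (use assms V in auto)
    then show "\<exists>V. open V \<and> x \<in> V \<and> Ck_on k V f"
      using assms V \<open>x \<in> S\<close> by (intro exI[of _ "S \<inter> V"]) auto
  qed
  then show "\<forall>k. Ck_on k S f" ..
qed (use assms in \<open>auto simp: smooth_on_def\<close>)

lemma smooth_on_subset: "smooth_on S f \<Longrightarrow> T \<subseteq> S \<Longrightarrow> smooth_on T f"
  unfolding smooth_on_def by (intro ballI, drule bspec, blast) blast

lemma smooth_on_cong: "smooth_on S f \<Longrightarrow> (\<And>x. x \<in> S \<Longrightarrow> f x = g x) \<Longrightarrow> smooth_on S g"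
  unfolding smooth_on_def by auto

lemma smooth_on_imp_continuous_on:
  assumes "smooth_on S f"
  shows "continuous_on S f"
  unfolding continuous_on_eq_continuous_within
proof
  fix x assume x: "x \<in> S"
  then obtain V h where V: "open V" "x \<in> V" "Ck_on 0 V h" "\<And>y. y \<in> S \<inter> V \<Longrightarrow> h y = f y"
    using smooth_onE[OF assms] by metis
  have "continuous (at x within S) h"
    using V by (metis Ck_on.simps(1) continuous_at_imp_continuous_at_within continuous_on_eq_continuous_at)
  moreover have "\<forall>\<^sub>F y in at x within S. h y = f y"
    using V(1,2,4) unfolding eventually_at_topological by auto
  ultimately show "continuous (at x within S) f"
    using V(2) V(4)[of x] x tendsto_cong[of h f "at x within S"] unfolding continuous_within by simp
qed

lemma smooth_on_compose:
  fixes f :: "'a::real_normed_vector \<Rightarrow> 'b::euclidean_space"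
  assumes "smooth_on S f" "smooth_on T g" "f ` S \<subseteq> T"
  shows "smooth_on S (\<lambda>x. g (f x))"
proof (rule smooth_onI)
  fix x assume x: "x \<in> S"
  then have "f x \<in> T" using assms(3) by auto
  obtain V h where V: "open V" "x \<in> V" "\<And>k. Ck_on k V h" "\<And>y. y \<in> S \<inter> V \<Longrightarrow> h y = f y"
    using smooth_onE[OF assms(1) x] by metis
  obtain W e where W: "open W" "f x \<in> W" "\<And>k. Ck_on k W e" "\<And>y. y \<in> T \<inter> W \<Longrightarrow> e y = g y"
    using smooth_onE[OF assms(2) \<open>f x \<in> T\<close>] by metis
  \<comment> \<open>The neighbourhood is cut down by the extension \<open>h\<close>, which is
    continuous on all of \<open>V\<close>, since \<open>f\<close> is controlled on \<open>S\<close>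
    only.\<close>
  have o: "open (V \<inter> h -` W)"
    using V(1) W(1) V(3)[of 0] by (auto simp: continuous_on_open_vimage Int_commute)
  show "\<exists>V' e'. open V' \<and> x \<in> V' \<and> (\<forall>k. Ck_on k V' e') \<and> (\<forall>y\<in>S \<inter> V'. e' y = g (f y))"
  proof (intro exI conjI allI)
    show "Ck_on k (V \<inter> h -` W) (\<lambda>x. e (h x))" for k
      by (rule Ck_on_compose[OF o W(1) _ Ck_on_subset[OF V(3)] W(3)]) auto
  qed (use o V W x assms(3) in \<open>auto simp: image_subset_iff\<close>)
qed

lemma smooth_on_bounded_linear:
  assumes "bounded_linear L"
  shows "smooth_on S L"
proof -
  have "smooth_on UNIV L"
    unfolding smooth_on_open_iff[OF open_UNIV]
    using Ck_on_bounded_linear[OF assms open_UNIV Ck_on_id] by auto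
  then show ?thesis by (rule smooth_on_subset) auto
qed

lemma smooth_on_Pair:
  assumes "smooth_on S f" "smooth_on S g"
  shows "smooth_on S (\<lambda>x. (f x, g x))"
proof (rule smooth_onI)
  fix x assume x: "x \<in> S"
  obtain V h where V: "open V" "x \<in> V" "\<And>k. Ck_on k V h" "\<And>y. y \<in> S \<inter> V \<Longrightarrow> h y = f y"
    using smooth_onE[OF assms(1) x] by metis
  obtain W e where W: "open W" "x \<in> W" "\<And>k. Ck_on k W e" "\<And>y. y \<in> S \<inter> W \<Longrightarrow> e y = g y"
    using smooth_onE[OF assms(2) x] by metis
  show "\<exists>V' e'. open V' \<and> x \<in> V' \<and> (\<forall>k. Ck_on k V' e') \<and> (\<forall>y\<in>S \<inter> V'. e' y = (f y, g y))"
    using V W by (intro exI[of _ "V \<inter> W"] exI[of _ "\<lambda>y. (h y, e y)"] conjI)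
      (auto intro!: Ck_on_Pair intro: Ck_on_subset)
qed

section \<open>Tangent vectors in a chart\<close>

text \<open>The inverse of the differential of the chart \<open>\<phi>\<close> at \<open>x\<close>,
  as a map from coordinates into the ambient space. It is taken as the derivative of the inverse
  chart because that map lives on an open set, where the ordinary Frechet derivative makes
  sense.\<close>

definition coord_vector ::
  "'a::euclidean_space set \<Rightarrow> ('a \<Rightarrow> 'b::euclidean_space) \<Rightarrow> 'a \<Rightarrow> 'b \<Rightarrow> 'a" where
  "coord_vector U \<phi> x w = frechet_derivative (inv_into U \<phi>) (at (\<phi> x)) w"

text \<open>Reconciles two uses of curves: \<open>tangent_space M\<close> takes curves in
  \<open>M\<close>, \<open>tangent_map U\<close> takes curves in \<open>U\<close>. By continuity a
  curve through \<open>x\<close> stays in the open piece \<open>U\<close> for a short time.\<close>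

lemma smooth_curve_openin:
  assumes "smooth_curve M x v \<gamma>" "openin (top_of_set M) U" "x \<in> U"
  shows "smooth_curve U x v \<gamma>"
proof -
  obtain \<epsilon> where \<epsilon>: "\<epsilon> > 0" "smooth_on {-\<epsilon><..<\<epsilon>} \<gamma>" "\<gamma> ` {-\<epsilon><..<\<epsilon>} \<subseteq> M"
    using assms(1) unfolding smooth_curve_def by metis
  obtain O' where O': "open O'" "U = M \<inter> O'"
    using assms(2) by (auto simp: openin_open)
  have "open ({-\<epsilon><..<\<epsilon>} \<inter> \<gamma> -` O')"
    using smooth_on_imp_continuous_on[OF \<epsilon>(2)] O'(1)
    by (simp add: continuous_on_open_vimage Int_commute)
  moreover have "0 \<in> {-\<epsilon><..<\<epsilon>} \<inter> \<gamma> -` O'"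
    using \<epsilon>(1) assms(1,3) O'(2) by (auto simp: smooth_curve_def)
  ultimately obtain \<delta> where \<delta>: "\<delta> > 0" "ball 0 \<delta> \<subseteq> {-\<epsilon><..<\<epsilon>} \<inter> \<gamma> -` O'"
    by (meson open_contains_ball)
  have b: "{-\<delta><..<\<delta>} \<subseteq> {-\<epsilon><..<\<epsilon>} \<inter> \<gamma> -` O'"
    using \<delta>(2) by (simp add: ball_eq_greaterThanLessThan)
  then have "smooth_on {-\<delta><..<\<delta>} \<gamma>"
    by (intro smooth_on_subset[OF \<epsilon>(2)]) auto
  moreover have "\<gamma> ` {-\<delta><..<\<delta>} \<subseteq> U"
    using b \<epsilon>(3) O'(2) by auto
  ultimately show ?thesis
    using assms(1) \<delta>(1) unfolding smooth_curve_def by blast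
qed

locale smooth_chart =
  fixes M :: "'a::euclidean_space set" and U :: "'a set" and \<phi> :: "'a \<Rightarrow> 'b::euclidean_space"
  assumes chart: "(U, \<phi>) \<in> smooth_structure M"
begin

lemma
  shows openin_dom: "openin (top_of_set M) U"
    and open_image: "open (\<phi> ` U)"
    and inj: "inj_on \<phi> U"
    and smooth_on_chart: "smooth_on U \<phi>"
    and smooth_on_inv: "smooth_on (\<phi> ` U) (inv_into U \<phi>)"
  using chart unfolding smooth_structure_def diffeomorphism_on_def bij_betw_def by auto

lemma dom_subset: "U \<subseteq> M"
  using openin_dom openin_imp_subset by blast

lemma inv_chart [simp]: "x \<in> U \<Longrightarrow> inv_into U \<phi> (\<phi> x) = x"
  using inj by simp

lemma has_derivative_inv:
  assumes "x \<in> U"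
  shows "(inv_into U \<phi> has_derivative coord_vector U \<phi> x) (at (\<phi> x))"
proof -
  have "Ck_on (Suc 0) (\<phi> ` U) (inv_into U \<phi>)"
    using smooth_on_inv smooth_on_open_iff[OF open_image] by blast
  from Ck_on_Suc_has_derivative[OF this, of "\<phi> x"] assms show ?thesis
    by (simp add: coord_vector_def[abs_def])
qed

lemma linear_coord_vector: "x \<in> U \<Longrightarrow> linear (coord_vector U \<phi> x)"
  using has_derivative_inv has_derivative_linear by blast

section \<open>Derivatives of a local ambient extension of a chart\<close>

context
  fixes V h
  assumes V: "open V" and h: "\<And>k. Ck_on k V h" and h_eq: "\<And>y. y \<in> U \<inter> V \<Longrightarrow> h y = \<phi> y"
begin

lemma extension_has_derivative:
  "x \<in> V \<Longrightarrow> (h has_derivative frechet_derivative h (at x)) (at x)"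
  using Ck_on_Suc_has_derivative[OF h[of "Suc 0"]] .

text \<open>Near \<open>\<phi> x\<close> the composite of \<open>h\<close> with the inverse chart is
  the identity; compare its derivative by the chain rule with that of the identity.\<close>

lemma extension_derivative_coord_vector:
  assumes "x \<in> U \<inter> V"
  shows "frechet_derivative h (at x) (coord_vector U \<phi> x w) = w"
proof -
  let ?W = "\<phi> ` U \<inter> inv_into U \<phi> -` V"
  have o: "open ?W"
    using smooth_on_imp_continuous_on[OF smooth_on_inv] V open_image
    by (simp add: continuous_on_open_vimage Int_commute)
  have x: "\<phi> x \<in> ?W"
    using assms by simp
  have d: "((\<lambda>z. h (inv_into U \<phi> z)) has_derivative
      (\<lambda>w. frechet_derivative h (at x) (coord_vector U \<phi> x w))) (at (\<phi> x))"
    using has_derivative_compose[OF has_derivative_inv, of x h] extension_has_derivative[of x] assms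
    by auto
  have eq: "h (inv_into U \<phi> z) = z" if "z \<in> ?W" for z
    using that h_eq by auto
  from fun_cong[OF has_derivative_unique[OF has_derivative_transform_within_open[OF d o x eq]
      has_derivative_ident]]
  show ?thesis .
qed

lemma has_vector_derivative_chart_curve:
  assumes "x \<in> U \<inter> V" "smooth_curve U x v \<gamma>"
  shows "(\<phi> \<circ> \<gamma> has_vector_derivative frechet_derivative h (at x) v) (at 0)"
proof -
  obtain \<epsilon> where \<epsilon>: "\<epsilon> > 0" "smooth_on {-\<epsilon><..<\<epsilon>} \<gamma>" "\<gamma> ` {-\<epsilon><..<\<epsilon>} \<subseteq> U"
    and \<gamma>: "\<gamma> 0 = x" "(\<gamma> has_vector_derivative v) (at 0)"
    using assms(2) unfolding smooth_curve_def by metis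
  \<comment> \<open>The times at which the curve lies in \<open>V\<close>; since it also stays in
    \<open>U\<close>, \<open>h\<close> and \<open>\<phi>\<close> agree along it there.\<close>
  let ?J = "{-\<epsilon><..<\<epsilon>} \<inter> \<gamma> -` V"
  have "open ?J"
    using smooth_on_imp_continuous_on[OF \<epsilon>(2)] V
    by (simp add: continuous_on_open_vimage Int_commute)
  moreover have "0 \<in> ?J"
    using \<epsilon>(1) \<gamma>(1) assms(1) by simp
  moreover have "((\<lambda>t. h (\<gamma> t)) has_vector_derivative frechet_derivative h (at x) v) (at 0)"
  proof -
    have d: "(h has_derivative frechet_derivative h (at x)) (at (\<gamma> 0))"
      using extension_has_derivative assms(1) \<gamma>(1) by simp
    show ?thesis
      using has_derivative_compose[OF \<gamma>(2)[unfolded has_vector_derivative_def] d]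
      by (simp add: has_vector_derivative_def linear_scale[OF has_derivative_linear[OF d]])
  qed
  moreover have "h (\<gamma> t) = (\<phi> \<circ> \<gamma>) t" if "t \<in> ?J" for t
    using h_eq[of "\<gamma> t"] that image_subset_iff[THEN iffD1, OF \<epsilon>(3), rule_format, of t] by simp
  ultimately show ?thesis
    by (intro has_vector_derivative_transform_within_open[where S = ?J and g = "\<phi> \<circ> \<gamma>"])
qed

text \<open>Differentiate \<open>inv_into U \<phi> (\<phi> (\<gamma> t)) = \<gamma> t\<close> at
  \<open>0\<close>. A curve is assumed because the derivative of \<open>h\<close> accepts every
  ambient vector, while the identity holds for tangent vectors only.\<close>

lemma coord_vector_extension_derivative:
  assumes "x \<in> U \<inter> V" "smooth_curve U x v \<gamma>"
  shows "coord_vector U \<phi> x (frechet_derivative h (at x) v) = v"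
proof -
  obtain \<epsilon> where \<epsilon>: "\<epsilon> > 0" "\<gamma> ` {-\<epsilon><..<\<epsilon>} \<subseteq> U"
    and \<gamma>: "\<gamma> 0 = x" "(\<gamma> has_vector_derivative v) (at 0)"
    using assms(2) unfolding smooth_curve_def by metis
  have d: "(inv_into U \<phi> has_derivative coord_vector U \<phi> x) (at ((\<phi> \<circ> \<gamma>) 0))"
    using has_derivative_inv assms(1) \<gamma>(1) by simp
  have "((\<lambda>t. inv_into U \<phi> ((\<phi> \<circ> \<gamma>) t)) has_vector_derivative
      coord_vector U \<phi> x (frechet_derivative h (at x) v)) (at 0)"
    using has_derivative_compose[OF has_vector_derivative_chart_curve[OF assms,
        unfolded has_vector_derivative_def] d]
    by (simp add: has_vector_derivative_def linear_scale[OF has_derivative_linear[OF d]])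
  then have "(\<gamma> has_vector_derivative coord_vector U \<phi> x (frechet_derivative h (at x) v)) (at 0)"
    by (rule has_vector_derivative_transform_within_open[where S = "{-\<epsilon><..<\<epsilon>}"])
      (use \<epsilon> in \<open>auto simp: image_subset_iff\<close>)
  from vector_derivative_unique_at[OF this \<gamma>(2)] show ?thesis .
qed

text \<open>Shows that the definite description in \<open>tangent_map\<close> denotes: all curves
  representing \<open>v\<close> give the same velocity in coordinates, and at least one such curve
  exists. In particular the derivative of \<open>h\<close> on tangent vectors does not depend on the
  chosen extension.\<close>

lemma tangent_map_eq_extension_derivative:
  assumes "x \<in> U \<inter> V" "v \<in> tangent_space M x"
  shows "tangent_map U \<phi> x v = frechet_derivative h (at x) v"
proof -
  obtain \<gamma> where "smooth_curve M x v \<gamma>"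
    using assms(2) by (auto simp: tangent_space_def)
  then have "smooth_curve U x v \<gamma>"
    using smooth_curve_openin[OF _ openin_dom] assms(1) by blast
  note \<gamma> = this
  show ?thesis
    unfolding tangent_map_def
  proof (rule the_equality)
    show "\<forall>\<gamma>. smooth_curve U x v \<gamma> \<longrightarrow>
        (\<phi> \<circ> \<gamma> has_vector_derivative frechet_derivative h (at x) v) (at 0)"
      using has_vector_derivative_chart_curve[OF assms(1)] by blast
    fix w assume "\<forall>\<gamma>. smooth_curve U x v \<gamma> \<longrightarrow> (\<phi> \<circ> \<gamma> has_vector_derivative w) (at 0)"
    then have "(\<phi> \<circ> \<gamma> has_vector_derivative w) (at 0)"
      using \<gamma> by simp
    from vector_derivative_unique_at[OF this has_vector_derivative_chart_curve[OF assms(1) \<gamma>]]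
    show "w = frechet_derivative h (at x) v" .
  qed
qed

end

section \<open>The differential of a chart as a linear isomorphism of the tangent space\<close>

lemma extensionE:
  assumes "x \<in> U"
  obtains V h where "open V" "x \<in> V" "\<And>k. Ck_on k V h" "\<And>y. y \<in> U \<inter> V \<Longrightarrow> h y = \<phi> y"
  using smooth_onE[OF smooth_on_chart assms] by metis

lemma coord_vector_in_tangent_space:
  assumes x: "x \<in> U"
  shows "coord_vector U \<phi> x w \<in> tangent_space M x"
proof -
  define c where "c = (\<lambda>t. \<phi> x + t *\<^sub>R w)"
  have c: "smooth_on UNIV c"
    unfolding smooth_on_open_iff[OF open_UNIV] c_def
    by (intro allI Ck_on_add Ck_on_const Ck_on_scaleR Ck_on_id open_UNIV)
  have "open (c -` (\<phi> ` U))"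
    using smooth_on_imp_continuous_on[OF c] open_image by (simp add: open_vimage)
  moreover have "0 \<in> c -` (\<phi> ` U)"
    using x by (simp add: c_def)
  ultimately obtain \<epsilon> where \<epsilon>: "\<epsilon> > 0" "ball 0 \<epsilon> \<subseteq> c -` (\<phi> ` U)"
    by (meson open_contains_ball)
  then have c_in: "c ` {-\<epsilon><..<\<epsilon>} \<subseteq> \<phi> ` U"
    by (auto simp: ball_eq_greaterThanLessThan)
  have "smooth_curve M x (coord_vector U \<phi> x w) (\<lambda>t. inv_into U \<phi> (c t))"
    unfolding smooth_curve_def
  proof (intro conjI exI[of _ \<epsilon>])
    show "smooth_on {-\<epsilon><..<\<epsilon>} (\<lambda>t. inv_into U \<phi> (c t))"
      by (rule smooth_on_compose[OF smooth_on_subset[OF c] smooth_on_inv c_in]) simp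
    show "(\<lambda>t. inv_into U \<phi> (c t)) ` {-\<epsilon><..<\<epsilon>} \<subseteq> M"
      using c_in inv_into_into[of _ \<phi> U] dom_subset by blast
    show "inv_into U \<phi> (c 0) = x"
      using x by (simp add: c_def)
    have d: "(inv_into U \<phi> has_derivative coord_vector U \<phi> x) (at (c 0))"
      using has_derivative_inv[OF x] by (simp add: c_def)
    have "(c has_derivative (\<lambda>t. t *\<^sub>R w)) (at 0)"
      unfolding c_def by (auto intro!: derivative_eq_intros)
    from has_derivative_compose[OF this d]
    show "((\<lambda>t. inv_into U \<phi> (c t)) has_vector_derivative coord_vector U \<phi> x w) (at 0)"
      by (simp add: has_vector_derivative_def linear_scale[OF has_derivative_linear[OF d]])
  qed (use \<epsilon> in auto)
  then show ?thesis
    unfolding tangent_space_def by (intro CollectI exI)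
qed

lemma tangent_map_coord_vector:
  assumes "x \<in> U"
  shows "tangent_map U \<phi> x (coord_vector U \<phi> x w) = w"
proof -
  obtain V h where Vh: "open V" "x \<in> V" "\<And>k. Ck_on k V h" "\<And>y. y \<in> U \<inter> V \<Longrightarrow> h y = \<phi> y"
    using extensionE[OF assms] by metis
  have x: "x \<in> U \<inter> V"
    using assms Vh by simp
  show ?thesis
    using extension_derivative_coord_vector[OF Vh(1,3,4) x]
      tangent_map_eq_extension_derivative[OF Vh(1,3,4) x coord_vector_in_tangent_space[OF assms]]
    by simp
qed

lemma coord_vector_tangent_map:
  assumes "x \<in> U" "v \<in> tangent_space M x"
  shows "coord_vector U \<phi> x (tangent_map U \<phi> x v) = v"
proof -
  obtain V h where Vh: "open V" "x \<in> V" "\<And>k. Ck_on k V h" "\<And>y. y \<in> U \<inter> V \<Longrightarrow> h y = \<phi> y"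
    using extensionE[OF assms(1)] by metis
  have x: "x \<in> U \<inter> V"
    using assms Vh by simp
  obtain \<gamma> where "smooth_curve M x v \<gamma>"
    using assms(2) by (auto simp: tangent_space_def)
  then have "smooth_curve U x v \<gamma>"
    using smooth_curve_openin[OF _ openin_dom] assms(1) by blast
  then show ?thesis
    using coord_vector_extension_derivative[OF Vh(1,3,4) x]
      tangent_map_eq_extension_derivative[OF Vh(1,3,4) x assms(2)] by simp
qed

text \<open>Velocities of curves are not visibly closed under addition; as the range of a linear map
  they form a subspace.\<close>

lemma tangent_space_eq_range:
  assumes "x \<in> U"
  shows "tangent_space M x = range (coord_vector U \<phi> x)"
proof
  show "tangent_space M x \<subseteq> range (coord_vector U \<phi> x)"
  proof
    fix v assume "v \<in> tangent_space M x"
    from coord_vector_tangent_map[OF assms this] show "v \<in> range (coord_vector U \<phi> x)"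
      by (rule range_eqI[OF sym])
  qed
  show "range (coord_vector U \<phi> x) \<subseteq> tangent_space M x"
    using coord_vector_in_tangent_space[OF assms] by (intro image_subsetI)
qed

lemma subspace_tangent_space: "x \<in> U \<Longrightarrow> subspace (tangent_space M x)"
  unfolding tangent_space_eq_range
  by (intro linear_subspace_image linear_coord_vector subspace_UNIV)

text \<open>Linearity passes to the inverse: \<open>coord_vector\<close> sends the sum of the
  coordinates to \<open>v + v'\<close>, and taking coordinates again recovers that sum.\<close>

lemma tangent_map_add:
  assumes "x \<in> U" "v \<in> tangent_space M x" "v' \<in> tangent_space M x"
  shows "tangent_map U \<phi> x (v + v') = tangent_map U \<phi> x v + tangent_map U \<phi> x v'"
  using tangent_map_coord_vector[OF assms(1), of "tangent_map U \<phi> x v + tangent_map U \<phi> x v'"]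
  by (simp add: linear_add[OF linear_coord_vector] coord_vector_tangent_map assms)

lemma tangent_map_scaleR:
  assumes "x \<in> U" "v \<in> tangent_space M x"
  shows "tangent_map U \<phi> x (r *\<^sub>R v) = r *\<^sub>R tangent_map U \<phi> x v"
  using tangent_map_coord_vector[OF assms(1), of "r *\<^sub>R tangent_map U \<phi> x v"]
  by (simp add: linear_scale[OF linear_coord_vector] coord_vector_tangent_map assms)

text \<open>Factors as the smooth map applying \<open>\<phi>\<close> to the base point, followed by
  the derivative of the inverse chart, which is jointly smooth on an open set.\<close>

lemma smooth_on_coord_vector: "smooth_on (U \<times> UNIV) (\<lambda>p. coord_vector U \<phi> (fst p) (snd p))"
proof -
  let ?D = "\<lambda>p. frechet_derivative (inv_into U \<phi>) (at (fst p)) (snd p)"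
  have "Ck_on (Suc k) (\<phi> ` U) (inv_into U \<phi>)" for k
    using smooth_on_inv smooth_on_open_iff[OF open_image] by blast
  then have "Ck_on k (\<phi> ` U \<times> UNIV) ?D" for k
    by (rule Ck_on_derivative[OF open_image])
  then have D: "smooth_on (\<phi> ` U \<times> UNIV) ?D"
    using open_image by (simp add: smooth_on_open_iff open_Times)
  have "smooth_on (U \<times> UNIV) (\<lambda>p. (\<phi> (fst p), snd p))"
    by (intro smooth_on_Pair smooth_on_compose[OF _ smooth_on_chart]
        smooth_on_bounded_linear bounded_linear_fst bounded_linear_snd) auto
  from smooth_on_compose[OF this D] show ?thesis
    by (simp add: coord_vector_def image_subset_iff)
qed

text \<open>The domain need not be open in the ambient space, so an extension has to be exhibited
  near each point: the derivative of a local extension \<open>h\<close>, defined on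
  \<open>V \<times> UNIV\<close>, agrees with \<open>tangent_map\<close> on tangent vectors.\<close>

lemma smooth_on_tangent_map:
  "smooth_on (Sigma U (tangent_space M)) (\<lambda>p. tangent_map U \<phi> (fst p) (snd p))"
proof (rule smooth_onI)
  fix p assume p: "p \<in> Sigma U (tangent_space M)"
  then have x: "fst p \<in> U" by auto
  obtain V h where Vh: "open V" "fst p \<in> V" "\<And>k. Ck_on k V h" "\<And>y. y \<in> U \<inter> V \<Longrightarrow> h y = \<phi> y"
    using extensionE[OF x] by metis
  show "\<exists>V' h'. open V' \<and> p \<in> V' \<and> (\<forall>k. Ck_on k V' h') \<and>
      (\<forall>q\<in>Sigma U (tangent_space M) \<inter> V'. h' q = tangent_map U \<phi> (fst q) (snd q))"
  proof (intro exI conjI allI ballI)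
    show "open (V \<times> (UNIV :: 'a set))"
      using Vh(1) by (simp add: open_Times)
    show "Ck_on k (V \<times> UNIV) (\<lambda>q. frechet_derivative h (at (fst q)) (snd q))" for k
      using Ck_on_derivative[OF Vh(1,3)] .
    show "frechet_derivative h (at (fst q)) (snd q) = tangent_map U \<phi> (fst q) (snd q)"
      if "q \<in> Sigma U (tangent_space M) \<inter> V \<times> UNIV" for q
      using tangent_map_eq_extension_derivative[OF Vh(1,3,4), of "fst q" "snd q"] that by auto
    show "p \<in> V \<times> UNIV"
      using Vh(2) by (simp add: mem_Times_iff)
  qed
qed

end

text \<open>Near the point, \<open>\<phi>'\<close> is replaced by an ambient extension
  \<open>h\<close>, so that the ordinary chain rule with the inverse chart applies. The vectors fed
  into the derivative of \<open>h\<close> are tangent, hence it may be renamed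
  \<open>tangent_map\<close>.\<close>

lemma has_derivative_chart_transition:
  assumes "smooth_chart M U \<phi>" "smooth_chart M U' \<phi>'" and x: "x \<in> U \<inter> U'"
  shows "((\<lambda>z. \<phi>' (inv_into U \<phi> z)) has_derivative
    (\<lambda>w. tangent_map U' \<phi>' x (coord_vector U \<phi> x w))) (at (\<phi> x))"
proof -
  interpret A: smooth_chart M U \<phi> by fact
  interpret B: smooth_chart M U' \<phi>' by fact
  obtain V h where Vh: "open V" "x \<in> V" "\<And>k. Ck_on k V h" "\<And>y. y \<in> U' \<inter> V \<Longrightarrow> h y = \<phi>' y"
    using B.extensionE[of x] x by (metis IntD2)
  have xV: "x \<in> U' \<inter> V"
    using x Vh by simp
  obtain O' where O': "open O'" "U' = M \<inter> O'"
    using B.openin_dom by (auto simp: openin_open)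
  \<comment> \<open>Codes of points lying in \<open>V\<close> and, through \<open>O'\<close>, in
    \<open>U'\<close>; there \<open>h\<close> and \<open>\<phi>'\<close> agree.\<close>
  let ?W = "\<phi> ` U \<inter> inv_into U \<phi> -` (V \<inter> O')"
  have o: "open ?W"
    using continuous_on_open_vimage[OF A.open_image, THEN iffD1,
        OF smooth_on_imp_continuous_on[OF A.smooth_on_inv], rule_format, OF open_Int[OF Vh(1) O'(1)]]
    by (simp add: Int_commute)
  have xW: "\<phi> x \<in> ?W"
    using x Vh O' by simp
  have d: "((\<lambda>z. h (inv_into U \<phi> z)) has_derivative
      (\<lambda>w. frechet_derivative h (at x) (coord_vector U \<phi> x w))) (at (\<phi> x))"
    using has_derivative_compose[OF A.has_derivative_inv, of x h]
      B.extension_has_derivative[OF Vh(1,3,4), of x] x Vh(2) by auto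
  have eq: "h (inv_into U \<phi> z) = \<phi>' (inv_into U \<phi> z)" if "z \<in> ?W" for z
    using that Vh(4) O'(2) A.dom_subset by auto
  have "frechet_derivative h (at x) (coord_vector U \<phi> x w) = tangent_map U' \<phi>' x (coord_vector U \<phi> x w)" for w
    using B.tangent_map_eq_extension_derivative[OF Vh(1,3,4) xV] A.coord_vector_in_tangent_space x by simp
  with has_derivative_transform_within_open[OF d o xW eq] show ?thesis
    by simp
qed

section \<open>The tangent bundle\<close>

lemma b_over_subset_topspace: "b_over B U \<subseteq> topspace (b_total B)"
  by (auto simp: b_over_def)

text \<open>Serves twice: as local triviality of the tangent bundle and, read backwards, as the
  parametrization of one piece of it by a summand of the disjoint union.\<close>

lemma (in smooth_chart) homeomorphic_maps_tangent_trivialization: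
  "homeomorphic_maps (top_of_set (Sigma U (tangent_space M))) (top_of_set (U \<times> UNIV))
     (\<lambda>p. (fst p, tangent_map U \<phi> (fst p) (snd p))) (\<lambda>p. (fst p, coord_vector U \<phi> (fst p) (snd p)))"
proof -
  have "continuous_on (Sigma U (tangent_space M)) (\<lambda>p. (fst p, tangent_map U \<phi> (fst p) (snd p)))"
    by (intro smooth_on_imp_continuous_on smooth_on_Pair smooth_on_tangent_map
        smooth_on_bounded_linear bounded_linear_fst)
  moreover have "continuous_on (U \<times> UNIV) (\<lambda>p. (fst p, coord_vector U \<phi> (fst p) (snd p)))"
    by (intro smooth_on_imp_continuous_on smooth_on_Pair smooth_on_coord_vector
        smooth_on_bounded_linear bounded_linear_fst)
  ultimately show ?thesis
    unfolding homeomorphic_maps_def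
    by (auto simp: coord_vector_in_tangent_space tangent_map_coord_vector coord_vector_tangent_map)
qed

lemma tangent_bundle_simps:
  "b_total (tangent_bundle M) = top_of_set (Sigma M (tangent_space M))"
  "b_proj (tangent_bundle M) = fst"
  "b_add (tangent_bundle M) e e' = (fst e, snd e + snd e')"
  "b_scale (tangent_bundle M) r e = (fst e, r *\<^sub>R snd e)"
  "b_trivs (tangent_bundle M) = (\<lambda>(U, \<phi>). (U, \<lambda>(x, v). tangent_map U \<phi> x v)) ` smooth_structure M"
  by (simp_all add: tangent_bundle_def)

lemma b_over_tangent_bundle:
  "U \<subseteq> M \<Longrightarrow> b_over (tangent_bundle M) U = Sigma U (tangent_space M)"
  by (auto simp: b_over_def tangent_bundle_simps)

lemma (in smooth_chart) triv_inv_tangent_bundle: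
  assumes "p \<in> U \<times> UNIV"
  shows "triv_inv (tangent_bundle M :: (_, _, 'b) vbundle) (U, \<lambda>(x, v). tangent_map U \<phi> x v) p =
    (fst p, coord_vector U \<phi> (fst p) (snd p))"
  unfolding triv_inv_def fst_conv b_over_tangent_bundle[OF dom_subset]
proof (rule inv_into_f_eq)
  let ?h = "triv_map (tangent_bundle M :: (_, _, 'b) vbundle) (U, \<lambda>(x, v). tangent_map U \<phi> x v)"
  show "inj_on ?h (Sigma U (tangent_space M))"
    by (rule inj_on_inverseI[where g = "\<lambda>p. (fst p, coord_vector U \<phi> (fst p) (snd p))"])
      (auto simp: triv_map_def tangent_bundle_simps coord_vector_tangent_map)
  show "?h (fst p, coord_vector U \<phi> (fst p) (snd p)) = p"
    using assms by (auto simp: triv_map_def tangent_bundle_simps tangent_map_coord_vector)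
qed (use assms in \<open>auto simp: coord_vector_in_tangent_space\<close>)

lemma smooth_on_tangent_transition:
  assumes "smooth_chart M U \<phi>" "smooth_chart M U' \<phi>'"
  shows "smooth_on ((U \<inter> U') \<times> UNIV)
    (\<lambda>p. tangent_map U' \<phi>' (fst p) (coord_vector U \<phi> (fst p) (snd p)))"
proof -
  interpret A: smooth_chart M U \<phi> by fact
  interpret B: smooth_chart M U' \<phi>' by fact
  have "smooth_on ((U \<inter> U') \<times> UNIV) (\<lambda>p. (fst p, coord_vector U \<phi> (fst p) (snd p)))"
    by (intro smooth_on_Pair smooth_on_subset[OF A.smooth_on_coord_vector]
        smooth_on_bounded_linear bounded_linear_fst) auto
  from smooth_on_compose[OF this B.smooth_on_tangent_map] show ?thesis
    by (simp add: image_subset_iff A.coord_vector_in_tangent_space)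
qed

text \<open>Each clause concerns one or two charts and follows from the results on differentials of
  charts; fibres are closed under the operations because tangent spaces are subspaces.\<close>

theorem smooth_vector_bundle_tangent_bundle:
  fixes M :: "'a::euclidean_space set"
  assumes "smooth_submanifold TYPE('b) M"
  shows "smooth_vector_bundle M (tangent_bundle M :: (_, _, 'b::euclidean_space) vbundle)"
proof -
  let ?B = "tangent_bundle M :: ('a \<times> 'a, 'a, 'b) vbundle"
  have chart: "\<exists>U \<phi>. smooth_chart M U (\<phi> :: 'a \<Rightarrow> 'b) \<and> x \<in> U" if "x \<in> M" for x
    using bspec[OF assms[unfolded smooth_submanifold_def] that] by (auto simp: smooth_chart_def)
  have trivs: "\<exists>U \<phi>. smooth_chart M U \<phi> \<and> t = (U, \<lambda>(x, v). tangent_map U \<phi> x v)"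
    if "t \<in> b_trivs ?B" for t
  proof -
    obtain c where c: "c \<in> smooth_structure M" "t = (case c of (U, \<phi>) \<Rightarrow> (U, \<lambda>(x, v). tangent_map U \<phi> x v))"
      using \<open>t \<in> b_trivs ?B\<close> unfolding tangent_bundle_simps by (rule imageE)
    obtain U \<phi> where "c = (U, \<phi>)"
      by (cases c)
    with c show ?thesis
      by (intro exI[of _ U] exI[of _ \<phi>]) (simp add: smooth_chart_def)
  qed
  have over: "b_over ?B {x} = {x} \<times> tangent_space M x" if "x \<in> M" for x
    using that by (subst b_over_tangent_bundle) auto
  have subspace: "subspace (tangent_space M x)" if "x \<in> M" for x
    using chart[OF that] by (auto intro: smooth_chart.subspace_tangent_space)
  show ?thesis
    unfolding smooth_vector_bundle_def
  proof (intro conjI ballI allI)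
    show "continuous_map (b_total ?B) (top_of_set M) (b_proj ?B)"
      by (auto simp: tangent_bundle_simps intro: continuous_on_fst continuous_on_id)
    show "b_add ?B e e' \<in> b_over ?B {x}" if "x \<in> M" "e \<in> b_over ?B {x}" "e' \<in> b_over ?B {x}" for x e e'
      using that subspace_add[OF subspace[OF that(1)]] by (auto simp: over) (auto simp: tangent_bundle_simps)
    show "b_scale ?B r e \<in> b_over ?B {x}" if "x \<in> M" "e \<in> b_over ?B {x}" for x e r
      using that subspace_scale[OF subspace[OF that(1)]] by (auto simp: over) (auto simp: tangent_bundle_simps)
    show "(\<Union>t\<in>b_trivs ?B. fst t) = M"
    proof
      show "(\<Union>t\<in>b_trivs ?B. fst t) \<subseteq> M"
        using trivs smooth_chart.dom_subset by (intro UN_least) force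
      show "M \<subseteq> (\<Union>t\<in>b_trivs ?B. fst t)"
      proof
        fix x assume "x \<in> M"
        then obtain U \<phi> where "smooth_chart M U (\<phi> :: 'a \<Rightarrow> 'b)" "x \<in> U"
          using chart by blast
        then show "x \<in> (\<Union>t\<in>b_trivs ?B. fst t)"
          by (auto simp: tangent_bundle_simps smooth_chart_def intro!: bexI[of _ "(U, \<phi>)"])
      qed
    qed
  next
    fix t assume "t \<in> b_trivs ?B"
    then obtain U \<phi> where c: "smooth_chart M U \<phi>" and t: "t = (U, \<lambda>(x, v). tangent_map U \<phi> x v)"
      using trivs by metis
    interpret smooth_chart M U \<phi> by (rule c)
    show "openin (top_of_set M) (fst t)"
      using openin_dom by (simp add: t)
    have "subtopology (b_total ?B) (b_over ?B (fst t)) = top_of_set (Sigma U (tangent_space M))"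
      unfolding t fst_conv b_over_tangent_bundle[OF dom_subset]
      using dom_subset
      by (simp add: tangent_bundle_simps subtopology_subtopology Sigma_mono Int_absorb1)
    moreover have "triv_map ?B t = (\<lambda>p. (fst p, tangent_map U \<phi> (fst p) (snd p)))"
      by (auto simp: t triv_map_def tangent_bundle_simps)
    ultimately show "homeomorphic_map (subtopology (b_total ?B) (b_over ?B (fst t)))
        (top_of_set (fst t \<times> UNIV)) (triv_map ?B t)"
      using homeomorphic_maps_imp_map[OF homeomorphic_maps_tangent_trivialization] by (simp add: t)
    fix x e assume x: "x \<in> fst t" and e: "e \<in> b_over ?B {x}"
    then have xM: "x \<in> M"
      using dom_subset t by auto
    show "snd t (b_add ?B e e') = snd t e + snd t e'" if "e' \<in> b_over ?B {x}" for e'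
      using x e that tangent_map_add by (auto simp: over[OF xM] t tangent_bundle_simps)
    show "snd t (b_scale ?B r e) = r *\<^sub>R snd t e" for r
      using x e tangent_map_scaleR by (auto simp: over[OF xM] t tangent_bundle_simps)
  next
    fix t t' assume "t \<in> b_trivs ?B" "t' \<in> b_trivs ?B"
    then obtain U \<phi> U' \<phi>' where c: "smooth_chart M U \<phi>" "smooth_chart M U' \<phi>'"
      and t: "t = (U, \<lambda>(x, v). tangent_map U \<phi> x v)" "t' = (U', \<lambda>(x, v). tangent_map U' \<phi>' x v)"
      using trivs by metis
    show "smooth_on ((fst t \<inter> fst t') \<times> UNIV) (\<lambda>p. snd t' (triv_inv ?B t p))"
      by (rule smooth_on_cong[OF smooth_on_subset[OF smooth_on_tangent_transition[OF c]]])
        (auto simp: t smooth_chart.triv_inv_tangent_bundle[OF c(1)])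
  qed
qed

section \<open>Transport of vector bundles\<close>

lemma smooth_vector_bundle_triv_inv:
  assumes "smooth_vector_bundle M B" "t \<in> b_trivs B"
  shows "p \<in> fst t \<times> UNIV \<Longrightarrow> triv_inv B t p \<in> b_over B (fst t)"
    and "p \<in> fst t \<times> UNIV \<Longrightarrow> triv_map B t (triv_inv B t p) = p"
    and "p \<in> fst t \<times> UNIV \<Longrightarrow> b_proj B (triv_inv B t p) = fst p"
    and "inj_on (triv_map B t) (b_over B (fst t))"
proof -
  have hom: "homeomorphic_map (subtopology (b_total B) (b_over B (fst t)))
      (top_of_set (fst t \<times> UNIV)) (triv_map B t)"
    using assms unfolding smooth_vector_bundle_def by blast
  have top: "topspace (subtopology (b_total B) (b_over B (fst t))) = b_over B (fst t)"
    using b_over_subset_topspace[of B] by auto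
  have im: "triv_map B t ` b_over B (fst t) = fst t \<times> UNIV"
    using homeomorphic_imp_surjective_map[OF hom] unfolding top by simp
  show inj: "inj_on (triv_map B t) (b_over B (fst t))"
    using homeomorphic_imp_injective_map[OF hom] unfolding top .
  assume p: "p \<in> fst t \<times> UNIV"
  show "triv_inv B t p \<in> b_over B (fst t)"
    unfolding triv_inv_def by (rule inv_into_into) (use p im in simp)
  show eq: "triv_map B t (triv_inv B t p) = p"
    unfolding triv_inv_def by (rule f_inv_into_f) (use p im in simp)
  show "b_proj B (triv_inv B t p) = fst p"
    using arg_cong[OF eq, of fst] by (simp add: triv_map_def)
qed

text \<open>Only \<open>B\<close> is known to be a bundle beforehand. Each trivialization of
  \<open>B'\<close> pulls back along \<open>G\<close> to one of \<open>B\<close>, so every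
  smoothness claim about \<open>B'\<close>, about \<open>G\<close> and about the inverse
  \<open>F\<close> becomes the smoothness of a transition map of \<open>B\<close>.\<close>

lemma isomorphic_vector_bundles_transport:
  fixes B :: "('e, 'a::euclidean_space, 'b::euclidean_space) vbundle"
    and B' :: "('f, 'a, 'b) vbundle"
  assumes B: "smooth_vector_bundle M B"
    and G: "homeomorphic_map (b_total B) (b_total B') G"
    and proj: "\<And>e. e \<in> topspace (b_total B) \<Longrightarrow> b_proj B' (G e) = b_proj B e"
    and add: "\<And>x e e'. x \<in> M \<Longrightarrow> e \<in> b_over B {x} \<Longrightarrow> e' \<in> b_over B {x} \<Longrightarrow>
      b_add B' (G e) (G e') = G (b_add B e e')"
    and scale: "\<And>x e r. x \<in> M \<Longrightarrow> e \<in> b_over B {x} \<Longrightarrow> b_scale B' r (G e) = G (b_scale B r e)"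
    and cover: "(\<Union>t\<in>b_trivs B'. fst t) = M"
    and trivs: "\<And>t'. t' \<in> b_trivs B' \<Longrightarrow>
      \<exists>t\<in>b_trivs B. fst t = fst t' \<and> (\<forall>e\<in>b_over B (fst t). snd t' (G e) = snd t e)"
  shows "isomorphic_vector_bundles M B' B"
proof -
  obtain F where GF: "homeomorphic_maps (b_total B) (b_total B') G F"
    using G homeomorphic_map_maps by metis
  have Gcont: "continuous_map (b_total B) (b_total B') G"
    and Fcont: "continuous_map (b_total B') (b_total B) F"
    and FG: "\<And>e. e \<in> topspace (b_total B) \<Longrightarrow> F (G e) = e"
    and GFid: "\<And>e. e \<in> topspace (b_total B') \<Longrightarrow> G (F e) = e"
    using GF unfolding homeomorphic_maps_def by auto
  have Gtop: "\<And>e. e \<in> topspace (b_total B) \<Longrightarrow> G e \<in> topspace (b_total B')"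
    and Ftop: "\<And>e. e \<in> topspace (b_total B') \<Longrightarrow> F e \<in> topspace (b_total B)"
    using Gcont Fcont by (auto dest: continuous_map_funspace)
  have Fproj: "b_proj B (F e) = b_proj B' e" if "e \<in> topspace (b_total B')" for e
    using proj[OF Ftop[OF that]] GFid[OF that] by simp
  have Gover: "G e \<in> b_over B' U" if "e \<in> b_over B U" for e U
    using that proj Gtop by (simp add: b_over_def)
  have Fover: "F e \<in> b_over B U" if "e \<in> b_over B' U" for e U
    using that Fproj Ftop by (simp add: b_over_def)
  have top: "e \<in> topspace (b_total B)" if "e \<in> b_over B U" for e U
    using that by (simp add: b_over_def)
  have top': "e \<in> topspace (b_total B')" if "e \<in> b_over B' U" for e U
    using that by (simp add: b_over_def)
  have B_add: "b_add B e e' \<in> b_over B {x}"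
    if "x \<in> M" "e \<in> b_over B {x}" "e' \<in> b_over B {x}" for x e e'
    using B that unfolding smooth_vector_bundle_def by blast
  have B_scale: "b_scale B r e \<in> b_over B {x}" if "x \<in> M" "e \<in> b_over B {x}" for x e r
    using B that unfolding smooth_vector_bundle_def by blast
  have Fadd: "F (b_add B' e e') = b_add B (F e) (F e')"
    if x: "x \<in> M" and e: "e \<in> b_over B' {x}" "e' \<in> b_over B' {x}" for x e e'
    using add[OF x Fover[OF e(1)] Fover[OF e(2)]] FG[OF top[OF B_add[OF x Fover[OF e(1)] Fover[OF e(2)]]]]
    by (simp add: GFid top'[OF e(1)] top'[OF e(2)])
  have Fscale: "F (b_scale B' r e) = b_scale B r (F e)"
    if x: "x \<in> M" and e: "e \<in> b_over B' {x}" for x e r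
    using scale[OF x Fover[OF e]] FG[OF top[OF B_scale[OF x Fover[OF e]]]]
    by (simp add: GFid top'[OF e])

  \<comment> \<open>Fixes, for each trivialization of \<open>B'\<close>, one trivialization of
    \<open>B\<close> that corresponds to it under \<open>G\<close>.\<close>
  define partner where "partner t' = (SOME t. t \<in> b_trivs B \<and> fst t = fst t' \<and>
      (\<forall>e\<in>b_over B (fst t). snd t' (G e) = snd t e))" for t'
  have partner: "partner t' \<in> b_trivs B" "fst (partner t') = fst t'"
    "\<And>e. e \<in> b_over B (fst t') \<Longrightarrow> snd t' (G e) = snd (partner t') e" if "t' \<in> b_trivs B'" for t'
  proof -
    have "\<exists>t. t \<in> b_trivs B \<and> fst t = fst t' \<and> (\<forall>e\<in>b_over B (fst t). snd t' (G e) = snd t e)"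
      using trivs[OF that] by blast
    then have "partner t' \<in> b_trivs B \<and> fst (partner t') = fst t' \<and>
        (\<forall>e\<in>b_over B (fst (partner t')). snd t' (G e) = snd (partner t') e)"
      unfolding partner_def by (rule someI_ex)
    then show "partner t' \<in> b_trivs B" "fst (partner t') = fst t'"
      "\<And>e. e \<in> b_over B (fst t') \<Longrightarrow> snd t' (G e) = snd (partner t') e"
      by auto
  qed
  have snd_partner: "snd t' e = snd (partner t') (F e)"
    if "t' \<in> b_trivs B'" "e \<in> b_over B' (fst t')" for t' e
    using partner(3)[OF that(1) Fover[OF that(2)]] GFid[OF top'[OF that(2)]] by simp
  have triv_map_partner: "triv_map B' t' e = triv_map B (partner t') (F e)"
    if "t' \<in> b_trivs B'" "e \<in> b_over B' (fst t')" for t' e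
    using snd_partner[OF that] Fproj[OF top'[OF that(2)]] by (simp add: triv_map_def)
  \<comment> \<open>\<open>triv_inv\<close> is an \<open>inv_into\<close>, so it is identified by
    exhibiting a preimage and proving injectivity, which \<open>F\<close> carries over from the
    partner.\<close>
  have triv_inv_partner: "triv_inv B' t' p = G (triv_inv B (partner t') p)"
    if t': "t' \<in> b_trivs B'" and p: "p \<in> fst t' \<times> UNIV" for t' p
  proof -
    note inv = smooth_vector_bundle_triv_inv[OF B partner(1)[OF t'], unfolded partner(2)[OF t']]
    let ?e = "triv_inv B (partner t') p"
    have e: "?e \<in> b_over B (fst t')"
      by (rule inv(1)[OF p])
    show ?thesis
      unfolding triv_inv_def[of B']
    proof (rule inv_into_f_eq)
      show "inj_on (triv_map B' t') (b_over B' (fst t'))"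
      proof (rule inj_onI)
        fix d d' assume d: "d \<in> b_over B' (fst t')" "d' \<in> b_over B' (fst t')"
          and "triv_map B' t' d = triv_map B' t' d'"
        then have "F d = F d'"
          using inj_onD[OF inv(4) _ Fover[OF d(1)] Fover[OF d(2)]]
          by (simp add: triv_map_partner[OF t'])
        then show "d = d'"
          using GFid[OF top'[OF d(1)]] GFid[OF top'[OF d(2)]] by (rule box_equals[OF arg_cong])
      qed
      show "triv_map B' t' (G ?e) = p"
        using inv(2)[OF p] FG[OF top[OF e]] by (simp add: triv_map_partner[OF t' Gover[OF e]])
    qed (rule Gover[OF e])
  qed

  have B_smooth: "smooth_on ((fst t \<inter> fst s) \<times> UNIV) (\<lambda>p. snd s (triv_inv B t p))"
    if "t \<in> b_trivs B" "s \<in> b_trivs B" for t s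
    using B that unfolding smooth_vector_bundle_def by blast

  have B': "smooth_vector_bundle M B'"
    unfolding smooth_vector_bundle_def
  proof (intro conjI ballI allI)
    have "continuous_map (b_total B) (top_of_set M) (b_proj B)"
      using B unfolding smooth_vector_bundle_def by blast
    then have "continuous_map (b_total B') (top_of_set M) (b_proj B \<circ> F)"
      by (rule continuous_map_compose[OF Fcont])
    then show "continuous_map (b_total B') (top_of_set M) (b_proj B')"
      by (rule continuous_map_eq) (simp add: Fproj)
    show "b_add B' e e' \<in> b_over B' {x}"
      if "x \<in> M" "e \<in> b_over B' {x}" "e' \<in> b_over B' {x}" for x e e'
      using Gover[OF B_add[OF that(1) Fover[OF that(2)] Fover[OF that(3)]]]
        add[OF that(1) Fover[OF that(2)] Fover[OF that(3)]]
      by (simp add: GFid top'[OF that(2)] top'[OF that(3)])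
    show "b_scale B' r e \<in> b_over B' {x}" if "x \<in> M" "e \<in> b_over B' {x}" for x e r
      using Gover[OF B_scale[OF that(1) Fover[OF that(2)]]] scale[OF that(1) Fover[OF that(2)]]
      by (simp add: GFid top'[OF that(2)])
    show "(\<Union>t\<in>b_trivs B'. fst t) = M" by (rule cover)
  next
    fix t assume t: "t \<in> b_trivs B'"
    let ?U = "fst t"
    have part: "openin (top_of_set M) (fst (partner t)) \<and>
        homeomorphic_map (subtopology (b_total B) (b_over B (fst (partner t))))
          (top_of_set (fst (partner t) \<times> UNIV)) (triv_map B (partner t)) \<and>
        (\<forall>x\<in>fst (partner t). \<forall>e\<in>b_over B {x}.
           (\<forall>e'\<in>b_over B {x}. snd (partner t) (b_add B e e') = snd (partner t) e + snd (partner t) e') \<and>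
           (\<forall>r. snd (partner t) (b_scale B r e) = r *\<^sub>R snd (partner t) e))"
      using B partner(1)[OF t] unfolding smooth_vector_bundle_def by blast
    show U: "openin (top_of_set M) ?U"
      using part by (simp add: partner(2)[OF t])
    have "homeomorphic_map (b_total B') (b_total B) F"
      using GF homeomorphic_maps_map by blast
    \<comment> \<open>\<open>F\<close> covers the identity, so it restricts to the parts over
      \<open>fst t\<close>; the partner's trivialization after \<open>F\<close> is that of
      \<open>t\<close>.\<close>
    then have "homeomorphic_map (subtopology (b_total B') (b_over B' ?U))
        (subtopology (b_total B) (b_over B ?U)) F"
      by (rule homeomorphic_map_subtopologies_alt) (simp add: b_over_def Fproj)
    then have "homeomorphic_map (subtopology (b_total B') (b_over B' ?U))
        (top_of_set (?U \<times> UNIV)) (triv_map B (partner t) \<circ> F)"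
      using part by (auto simp: partner(2)[OF t] intro: homeomorphic_map_compose)
    then show "homeomorphic_map (subtopology (b_total B') (b_over B' ?U))
        (top_of_set (?U \<times> UNIV)) (triv_map B' t)"
      by (rule homeomorphic_map_eq) (simp add: triv_map_partner[OF t])
    fix x e assume x: "x \<in> ?U" and e: "e \<in> b_over B' {x}"
    have xM: "x \<in> M"
      using x U openin_imp_subset by blast
    have sub: "d \<in> b_over B' ?U" if "d \<in> b_over B' {x}" for d
      using that x by (auto simp: b_over_def)
    show "snd t (b_add B' e e') = snd t e + snd t e'" if e': "e' \<in> b_over B' {x}" for e'
    proof -
      have "b_add B' e e' \<in> b_over B' {x}"
        using Gover[OF B_add[OF xM Fover[OF e] Fover[OF e']]] add[OF xM Fover[OF e] Fover[OF e']]
        by (simp add: GFid top'[OF e] top'[OF e'])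
      then show ?thesis
        using part x Fover[OF e] Fover[OF e']
        by (simp add: snd_partner[OF t sub] e e' Fadd[OF xM] partner(2)[OF t])
    qed
    show "snd t (b_scale B' r e) = r *\<^sub>R snd t e" for r
    proof -
      have "b_scale B' r e \<in> b_over B' {x}"
        using Gover[OF B_scale[OF xM Fover[OF e]]] scale[OF xM Fover[OF e]]
        by (simp add: GFid top'[OF e])
      then show ?thesis
        using part x Fover[OF e]
        by (simp add: snd_partner[OF t sub] e Fscale[OF xM] partner(2)[OF t])
    qed
  next
    fix t s assume t: "t \<in> b_trivs B'" and s: "s \<in> b_trivs B'"
    note inv = smooth_vector_bundle_triv_inv[OF B partner(1)[OF t], unfolded partner(2)[OF t]]
    show "smooth_on ((fst t \<inter> fst s) \<times> UNIV) (\<lambda>p. snd s (triv_inv B' t p))"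
    proof (rule smooth_on_cong)
      show "smooth_on ((fst t \<inter> fst s) \<times> UNIV) (\<lambda>p. snd (partner s) (triv_inv B (partner t) p))"
        using B_smooth[OF partner(1)[OF t] partner(1)[OF s]] by (simp add: partner(2) t s)
      fix p :: "'a \<times> 'b" assume "p \<in> (fst t \<inter> fst s) \<times> UNIV"
      then have p: "p \<in> fst t \<times> UNIV" "fst p \<in> fst s"
        by auto
      \<comment> \<open>The point lies over \<open>fst t \<inter> fst s\<close>, hence in the region
        where \<open>s\<close> and its partner are comparable.\<close>
      have "triv_inv B (partner t) p \<in> b_over B (fst s)"
        using inv(1,3)[OF p(1)] p(2) by (simp add: b_over_def)
      then show "snd (partner s) (triv_inv B (partner t) p) = snd s (triv_inv B' t p)"
        by (simp add: triv_inv_partner[OF t p(1)] partner(3)[OF s])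
    qed
  qed

  have "bundle_hom M B' B F"
    unfolding bundle_hom_def
  proof (intro conjI ballI allI)
    fix t s assume t: "t \<in> b_trivs B'" and s: "s \<in> b_trivs B"
    note inv = smooth_vector_bundle_triv_inv[OF B partner(1)[OF t], unfolded partner(2)[OF t]]
    show "smooth_on ((fst t \<inter> fst s) \<times> UNIV) (\<lambda>p. snd s (F (triv_inv B' t p)))"
    proof (rule smooth_on_cong)
      show "smooth_on ((fst t \<inter> fst s) \<times> UNIV) (\<lambda>p. snd s (triv_inv B (partner t) p))"
        using B_smooth[OF partner(1)[OF t] s] by (simp add: partner(2) t)
      fix p :: "'a \<times> 'b" assume "p \<in> (fst t \<inter> fst s) \<times> UNIV"
      then have p: "p \<in> fst t \<times> UNIV"
        by auto
      \<comment> \<open>\<open>F\<close> cancels the \<open>G\<close> in the inverse trivialization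
        of \<open>B'\<close>, leaving a transition map of \<open>B\<close>.\<close>
      show "snd s (triv_inv B (partner t) p) = snd s (F (triv_inv B' t p))"
        by (simp add: triv_inv_partner[OF t p] FG[OF top[OF inv(1)[OF p]]])
    qed
  qed (use Fcont Fproj Fadd Fscale in auto)
  moreover have "bundle_hom M B B' G"
    unfolding bundle_hom_def
  proof (intro conjI ballI allI)
    fix t s assume t: "t \<in> b_trivs B" and s: "s \<in> b_trivs B'"
    note inv = smooth_vector_bundle_triv_inv[OF B t]
    show "smooth_on ((fst t \<inter> fst s) \<times> UNIV) (\<lambda>p. snd s (G (triv_inv B t p)))"
    proof (rule smooth_on_cong)
      show "smooth_on ((fst t \<inter> fst s) \<times> UNIV) (\<lambda>p. snd (partner s) (triv_inv B t p))"
        using B_smooth[OF t partner(1)[OF s]] by (simp add: partner(2) s)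
      fix p :: "'a \<times> 'b" assume "p \<in> (fst t \<inter> fst s) \<times> UNIV"
      then have p: "p \<in> fst t \<times> UNIV" "fst p \<in> fst s"
        by auto
      have "triv_inv B t p \<in> b_over B (fst s)"
        using inv(1,3)[OF p(1)] p(2) by (simp add: b_over_def)
      then show "snd (partner s) (triv_inv B t p) = snd s (G (triv_inv B t p))"
        by (simp add: partner(3)[OF s])
    qed
  qed (use Gcont proj add scale in auto)
  ultimately show ?thesis
    unfolding isomorphic_vector_bundles_def using B B' FG GFid by blast
qed

section \<open>The bundle glued from an autoencoder atlas\<close>

lemma topspace_quotient_topology: "topspace (quotient_topology X q) = q ` topspace X"
proof
  show "topspace (quotient_topology X q) \<subseteq> q ` topspace X"
    using openin_topspace[of "quotient_topology X q"] unfolding openin_quotient_topology by blast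
  have "{p \<in> topspace X. q p \<in> q ` topspace X} = topspace X"
    by blast
  then have "openin (quotient_topology X q) (q ` topspace X)"
    unfolding openin_quotient_topology by simp
  then show "q ` topspace X \<subseteq> topspace (quotient_topology X q)"
    by (rule openin_subset)
qed

lemma quotient_map_quotient_topology: "quotient_map X (quotient_topology X q) q"
  unfolding quotient_map_def topspace_quotient_topology openin_quotient_topology by blast

text \<open>The comparison map from tangent vectors to classes. Collecting the coordinates in all
  encoders around the base point avoids choosing an index.\<close>

definition ae_class ::
  "'i set \<Rightarrow> ('i \<Rightarrow> ('a::euclidean_space, 'b::euclidean_space) ae_chart) \<Rightarrow> 'a \<times> 'a \<Rightarrow> ('i \<times> 'a \<times> 'b) set" where
  "ae_class I A e = {(i, fst e, tangent_map (ae_dom (A i)) (ae_enc (A i)) (fst e) (snd e)) | i.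
     i \<in> I \<and> fst e \<in> ae_dom (A i)}"

text \<open>Openness of the encoder images, joined to the diffeomorphism clause of
  \<open>smooth_ae_chart\<close>, puts every encoder into \<open>smooth_structure M\<close>.\<close>

locale ae_atlas =
  fixes M :: "'a::euclidean_space set" and I :: "'i set"
    and A :: "'i \<Rightarrow> ('a, 'b::euclidean_space) ae_chart"
  assumes ae_atlas: "smooth_ae_atlas M I A"
    and open_enc_image: "\<And>i. i \<in> I \<Longrightarrow> open (ae_enc (A i) ` ae_dom (A i))"
begin

abbreviation "U i \<equiv> ae_dom (A i)"
abbreviation "E i \<equiv> ae_enc (A i)"

lemma smooth_chart: "i \<in> I \<Longrightarrow> smooth_chart M (U i) (E i)"
  using ae_atlas open_enc_image
  by (simp add: smooth_ae_atlas_def smooth_ae_chart_def smooth_chart_def smooth_structure_def)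

lemma Union_dom: "(\<Union>i\<in>I. U i) = M"
  using ae_atlas by (simp add: smooth_ae_atlas_def)

lemma dec_enc: "i \<in> I \<Longrightarrow> x \<in> U i \<Longrightarrow> ae_dec (A i) (E i x) = x"
  using ae_atlas by (simp add: smooth_ae_atlas_def smooth_ae_chart_def)

lemma ae_cocycle_eq:
  assumes i: "i \<in> I" and j: "j \<in> I" and x: "x \<in> U i \<inter> U j"
  shows "ae_cocycle A j i x w = tangent_map (U j) (E j) x (coord_vector (U i) (E i) x w)"
proof -
  interpret i: smooth_chart M "U i" "E i" by (rule smooth_chart[OF i])
  interpret j: smooth_chart M "U j" "E j" by (rule smooth_chart[OF j])
  let ?S = "E i ` (U i \<inter> U j)"
  obtain O' where O': "open O'" "U j = M \<inter> O'"
    using j.openin_dom by (auto simp: openin_open)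
  \<comment> \<open>The overlap in codes is the preimage of an ambient open set under the continuous
    inverse of the encoder. Its openness turns the derivative within it into the ordinary
    one.\<close>
  have "open (E i ` U i \<inter> inv_into (U i) (E i) -` O')"
    using continuous_on_open_vimage[OF i.open_image, THEN iffD1,
        OF smooth_on_imp_continuous_on[OF i.smooth_on_inv], rule_format, OF O'(1)]
    by (simp add: Int_commute)
  moreover have "E i ` U i \<inter> inv_into (U i) (E i) -` O' = ?S"
    using i.dom_subset O'(2) by auto
  ultimately have S: "open ?S"
    by simp
  have xS: "E i x \<in> ?S"
    using x by simp
  have eq: "E j (inv_into (U i) (E i) z) = ae_transition A j i z" if "z \<in> ?S" for z
    using that dec_enc[OF i] by (auto simp: ae_transition_def)
  have "(ae_transition A j i has_derivative
      (\<lambda>w. tangent_map (U j) (E j) x (coord_vector (U i) (E i) x w))) (at (E i x))"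
    by (rule has_derivative_transform_within_open[OF
          has_derivative_chart_transition[OF smooth_chart[OF i] smooth_chart[OF j] x] S xS eq])
  from fun_cong[OF frechet_derivative_at[OF this], of w] show ?thesis
    unfolding ae_cocycle_def at_within_open[OF xS S] by (rule sym)
qed

text \<open>By the cocycle formula, the entry with index \<open>j\<close> in the image is d(E_j)_x
  of one tangent vector fixed by \<open>(i, x, w)\<close>.\<close>

lemma ae_glue_class:
  assumes "i \<in> I" "x \<in> U i"
  shows "ae_glue I A `` {(i, x, w)} = ae_class I A (x, coord_vector (U i) (E i) x w)"
  unfolding ae_glue_def ae_class_def using assms by (auto simp: ae_cocycle_eq)

lemma mem_ae_class_iff:
  "(i, x, w) \<in> ae_class I A (y, v) \<longleftrightarrow> i \<in> I \<and> x = y \<and> y \<in> U i \<and> w = tangent_map (U i) (E i) y v"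
  by (auto simp: ae_class_def)

lemma chart_at: "x \<in> M \<Longrightarrow> \<exists>i\<in>I. x \<in> U i"
  using Union_dom by blast

text \<open>A single encoder around \<open>x\<close> suffices: its entry shows the base point and
  one coordinate vector, from which \<open>coord_vector\<close> recovers the tangent vector.\<close>

lemma inj_on_ae_class: "inj_on (ae_class I A) (Sigma M (tangent_space M))"
proof (rule inj_onI)
  fix e e' assume e: "e \<in> Sigma M (tangent_space M)" and e': "e' \<in> Sigma M (tangent_space M)"
    and eq: "ae_class I A e = ae_class I A e'"
  obtain x v y u where xv: "e = (x, v)" "e' = (y, u)"
    by (cases e, cases e')
  then obtain i where i: "i \<in> I" "x \<in> U i"
    using e chart_at[of x] by auto
  then have "(i, x, tangent_map (U i) (E i) x v) \<in> ae_class I A (x, v)"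
    by (simp add: mem_ae_class_iff)
  then have "(i, x, tangent_map (U i) (E i) x v) \<in> ae_class I A (y, u)"
    using eq xv by simp
  then have "x = y" "tangent_map (U i) (E i) x v = tangent_map (U i) (E i) x u"
    by (auto simp: mem_ae_class_iff)
  then have "v = u"
    using smooth_chart.coord_vector_tangent_map[OF smooth_chart[OF i(1)] i(2)] e e' xv
    by (metis mem_Sigma_iff)
  with \<open>x = y\<close> xv show "e = e'"
    by simp
qed

section \<open>The tangent bundle as a quotient of the disjoint union\<close>

definition "chart_sum = sum_topology (\<lambda>i. prod_topology (top_of_set (U i)) (euclidean :: 'b topology)) I"

definition "param p = (case p of (i, x, w) \<Rightarrow> (x, coord_vector (U i) (E i) x w))"

lemma topspace_chart_sum: "topspace chart_sum = Sigma I (\<lambda>i. U i \<times> UNIV)"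
  by (auto simp: chart_sum_def)

lemma prod_top: "prod_topology (top_of_set (U i)) (euclidean :: 'b topology) = top_of_set (U i \<times> UNIV)"
  using prod_topology_subtopology_eu[of "U i" "UNIV :: 'b set"] by simp

lemma homeomorphic_map_param:
  assumes "i \<in> I"
  shows "homeomorphic_map (top_of_set (U i \<times> UNIV)) (top_of_set (Sigma (U i) (tangent_space M)))
    (\<lambda>q. param (i, q))"
proof -
  have "(\<lambda>q. param (i, q)) = (\<lambda>q. (fst q, coord_vector (U i) (E i) (fst q) (snd q)))"
    by (auto simp: param_def)
  then show ?thesis
    using smooth_chart.homeomorphic_maps_tangent_trivialization[OF smooth_chart[OF assms]]
    by (simp add: homeomorphic_maps_map)
qed

text \<open>Continuity and openness are checked on each summand, where \<open>param\<close> is a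
  homeomorphism onto the part of the tangent bundle over \<open>U i\<close>; that part is open.
  Surjectivity holds because the domains cover \<open>M\<close>.\<close>

lemma quotient_map_param:
  "quotient_map chart_sum (top_of_set (Sigma M (tangent_space M))) param"
proof (rule continuous_open_imp_quotient_map)
  have sub: "Sigma (U i) (tangent_space M) \<subseteq> Sigma M (tangent_space M)" if "i \<in> I" for i
    using smooth_chart.dom_subset[OF smooth_chart[OF that]] by blast
  have cont: "continuous_map (top_of_set (U i \<times> UNIV)) (top_of_set (Sigma M (tangent_space M)))
      (\<lambda>q. param (i, q))" if "i \<in> I" for i
    using homeomorphic_imp_continuous_map[OF homeomorphic_map_param[OF that]] sub[OF that]
    by (auto simp: continuous_map_in_subtopology)
  have param_in: "param p \<in> Sigma M (tangent_space M)" if "p \<in> topspace chart_sum" for p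
  proof -
    obtain i q where p: "p = (i, q)" "i \<in> I" "q \<in> U i \<times> UNIV"
      using \<open>p \<in> topspace chart_sum\<close> unfolding topspace_chart_sum by blast
    then show ?thesis
      using continuous_map_funspace[OF cont[OF p(2)]] by auto
  qed
  show "continuous_map chart_sum (top_of_set (Sigma M (tangent_space M))) param"
    unfolding continuous_map_def
  proof (intro conjI allI impI)
    show "param \<in> topspace chart_sum \<rightarrow> topspace (top_of_set (Sigma M (tangent_space M)))"
      using param_in by simp
    fix S assume S: "openin (top_of_set (Sigma M (tangent_space M))) S"
    let ?P = "{p \<in> topspace chart_sum. param p \<in> S}"
    have "openin (top_of_set (U i \<times> UNIV)) {q. (i, q) \<in> ?P}" if "i \<in> I" for i
    proof -
      have "{q. (i, q) \<in> ?P} = {q \<in> topspace (top_of_set (U i \<times> UNIV)). param (i, q) \<in> S}"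
        using that by (auto simp: topspace_chart_sum)
      then show ?thesis
        using openin_continuous_map_preimage[OF cont[OF that] S] by simp
    qed
    then show "openin chart_sum ?P"
      using topspace_chart_sum by (auto simp: chart_sum_def openin_sum_topology prod_top)
  qed
  show "open_map chart_sum (top_of_set (Sigma M (tangent_space M))) param"
    unfolding open_map_def
  proof (intro allI impI)
    fix S assume S: "openin chart_sum S"
    have "S \<subseteq> Sigma I (\<lambda>i. U i \<times> UNIV)"
      using openin_subset[OF S] by (simp add: topspace_chart_sum)
    then have im: "param ` S = (\<Union>i\<in>I. (\<lambda>q. param (i, q)) ` {q. (i, q) \<in> S})"
      by (auto simp: image_iff)
    have "openin (top_of_set (Sigma M (tangent_space M))) ((\<lambda>q. param (i, q)) ` {q. (i, q) \<in> S})"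
      if i: "i \<in> I" for i
    proof (rule openin_trans)
      have "openin (top_of_set (U i \<times> UNIV)) {q. (i, q) \<in> S}"
        using S i by (simp add: chart_sum_def openin_sum_topology prod_top)
      then show "openin (top_of_set (Sigma (U i) (tangent_space M))) ((\<lambda>q. param (i, q)) ` {q. (i, q) \<in> S})"
        using homeomorphic_imp_open_map[OF homeomorphic_map_param[OF i]] unfolding open_map_def by blast
      obtain O' where O': "open O'" "U i = M \<inter> O'"
        using smooth_chart.openin_dom[OF smooth_chart[OF i]] by (auto simp: openin_open)
      \<comment> \<open>An ambient open set cutting out \<open>U i\<close> also cuts out the part of
        the tangent bundle over it.\<close>
      have "Sigma (U i) (tangent_space M) = Sigma M (tangent_space M) \<inter> (O' \<times> UNIV)"
        using O'(2) by auto
      then show "openin (top_of_set (Sigma M (tangent_space M))) (Sigma (U i) (tangent_space M))"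
        using O'(1) by (metis open_Times open_UNIV openin_open_Int)
    qed
    then show "openin (top_of_set (Sigma M (tangent_space M))) (param ` S)"
      unfolding im by blast
  qed
  show "param ` topspace chart_sum = topspace (top_of_set (Sigma M (tangent_space M)))"
  proof
    show "param ` topspace chart_sum \<subseteq> topspace (top_of_set (Sigma M (tangent_space M)))"
      unfolding topspace_euclidean_subtopology by (rule image_subsetI) (rule param_in)
    show "topspace (top_of_set (Sigma M (tangent_space M))) \<subseteq> param ` topspace chart_sum"
    proof
      fix e assume "e \<in> topspace (top_of_set (Sigma M (tangent_space M)))"
      then obtain x v where e: "e = (x, v)" "x \<in> M" "v \<in> tangent_space M x"
        by auto
      then obtain i where i: "i \<in> I" "x \<in> U i"
        using chart_at by blast
      have "e = param (i, x, tangent_map (U i) (E i) x v)"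
        using smooth_chart.coord_vector_tangent_map[OF smooth_chart[OF i(1)] i(2) e(3)]
        by (simp add: param_def e)
      then show "e \<in> param ` topspace chart_sum"
        using i by (simp add: topspace_chart_sum)
    qed
  qed
qed

text \<open>The gluing map factors as \<open>ae_class I A \<circ> param\<close>. Continuity of
  \<open>ae_class\<close> comes from \<open>param\<close> being a quotient map; as the second factor
  of a quotient map it is then itself one, and an injective quotient map is a homeomorphism.\<close>

lemma homeomorphic_map_ae_class:
  "homeomorphic_map (top_of_set (Sigma M (tangent_space M))) (b_total (ae_tangent_bundle I A))
     (ae_class I A)"
proof -
  let ?q = "\<lambda>p. ae_glue I A `` {p}"
  have total: "b_total (ae_tangent_bundle I A) = quotient_topology chart_sum ?q"
    by (simp add: ae_tangent_bundle_def chart_sum_def)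
  have "?q p = (ae_class I A \<circ> param) p" if "p \<in> topspace chart_sum" for p
  proof -
    obtain i x w where "p = (i, x, w)" "i \<in> I" "x \<in> U i"
      using \<open>p \<in> topspace chart_sum\<close> by (auto simp: topspace_chart_sum)
    then show ?thesis
      by (simp add: param_def ae_glue_class)
  qed
  then have comp: "quotient_map chart_sum (quotient_topology chart_sum ?q) (ae_class I A \<circ> param)"
    by (rule quotient_map_eq[OF quotient_map_quotient_topology])
  then have "continuous_map (top_of_set (Sigma M (tangent_space M))) (quotient_topology chart_sum ?q)
      (ae_class I A)"
    using continuous_compose_quotient_map_eq[OF quotient_map_param] quotient_imp_continuous_map by blast
  then have "quotient_map (top_of_set (Sigma M (tangent_space M))) (quotient_topology chart_sum ?q)
      (ae_class I A)"
    by (rule quotient_map_from_composition[OF quotient_imp_continuous_map[OF quotient_map_param] _ comp])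
  then show ?thesis
    unfolding homeomorphic_map_def total using inj_on_ae_class by simp
qed

theorem isomorphic_ae_tangent_bundle:
  assumes sub: "smooth_submanifold TYPE('b) M"
  shows "isomorphic_vector_bundles M (ae_tangent_bundle I A) (tangent_bundle M :: (_, _, 'b) vbundle)"
proof (rule isomorphic_vector_bundles_transport)
  let ?B = "tangent_bundle M :: ('a \<times> 'a, 'a, 'b) vbundle" and ?B' = "ae_tangent_bundle I A"
  show "smooth_vector_bundle M ?B"
    by (rule smooth_vector_bundle_tangent_bundle[OF sub])
  show "homeomorphic_map (b_total ?B) (b_total ?B') (ae_class I A)"
    unfolding tangent_bundle_simps by (rule homeomorphic_map_ae_class)
  show "b_proj ?B' (ae_class I A e) = b_proj ?B e" if "e \<in> topspace (b_total ?B)" for e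
  proof -
    obtain x v where e: "e = (x, v)" "x \<in> M"
      using \<open>e \<in> topspace (b_total ?B)\<close> by (auto simp: tangent_bundle_simps)
    with chart_at obtain i where "i \<in> I" "x \<in> U i"
      by blast
    \<comment> \<open>Some encoder is defined at \<open>x\<close>, so the class is nonempty and its
      base point is determined.\<close>
    then have "(THE x'. \<exists>i v'. (i, x', v') \<in> ae_class I A (x, v)) = x"
      by (intro the_equality) (auto simp: mem_ae_class_iff)
    then show ?thesis
      by (simp add: ae_tangent_bundle_def tangent_bundle_simps e)
  qed
  have over: "b_over ?B {x} = {x} \<times> tangent_space M x" if "x \<in> M" for x
    using that by (subst b_over_tangent_bundle) auto
  show "b_add ?B' (ae_class I A e) (ae_class I A e') = ae_class I A (b_add ?B e e')"
    if "x \<in> M" "e \<in> b_over ?B {x}" "e' \<in> b_over ?B {x}" for x e e'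
  proof -
    obtain v v' where e: "e = (x, v)" "e' = (x, v')" "v \<in> tangent_space M x" "v' \<in> tangent_space M x"
      using \<open>e \<in> b_over ?B {x}\<close> \<open>e' \<in> b_over ?B {x}\<close> unfolding over[OF \<open>x \<in> M\<close>] by blast
    \<comment> \<open>Classes are added index by index, which amounts to additivity of each
      d(E_i)_x.\<close>
    have "tangent_map (U i) (E i) x (v + v') = tangent_map (U i) (E i) x v + tangent_map (U i) (E i) x v'"
      if "i \<in> I" "x \<in> U i" for i
      using smooth_chart.tangent_map_add[OF smooth_chart[OF that(1)] that(2) e(3,4)] .
    then show ?thesis
      by (auto simp: ae_tangent_bundle_def tangent_bundle_simps e mem_ae_class_iff)
  qed
  show "b_scale ?B' r (ae_class I A e) = ae_class I A (b_scale ?B r e)"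
    if "x \<in> M" "e \<in> b_over ?B {x}" for x e r
  proof -
    obtain v where e: "e = (x, v)" "v \<in> tangent_space M x"
      using \<open>e \<in> b_over ?B {x}\<close> unfolding over[OF \<open>x \<in> M\<close>] by blast
    have "tangent_map (U i) (E i) x (r *\<^sub>R v) = r *\<^sub>R tangent_map (U i) (E i) x v"
      if "i \<in> I" "x \<in> U i" for i
      using smooth_chart.tangent_map_scaleR[OF smooth_chart[OF that(1)] that(2) e(2)] .
    then show ?thesis
      by (auto simp: ae_tangent_bundle_def tangent_bundle_simps e mem_ae_class_iff)
  qed
  show "(\<Union>t\<in>b_trivs ?B'. fst t) = M"
    using Union_dom by (simp add: ae_tangent_bundle_def)
  show "\<exists>t\<in>b_trivs ?B. fst t = fst t' \<and> (\<forall>e\<in>b_over ?B (fst t). snd t' (ae_class I A e) = snd t e)"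
    if "t' \<in> b_trivs ?B'" for t'
  proof -
    obtain i where i: "i \<in> I" and t': "t' = (U i, \<lambda>C. THE v. \<exists>x. (i, x, v) \<in> C)"
      using \<open>t' \<in> b_trivs ?B'\<close> by (auto simp: ae_tangent_bundle_def)
    interpret smooth_chart M "U i" "E i" by (rule smooth_chart[OF i])
    have "(U i, \<lambda>(x, v). tangent_map (U i) (E i) x v) \<in> b_trivs ?B"
      unfolding tangent_bundle_simps by (rule image_eqI[OF _ chart]) simp
    \<comment> \<open>Over \<open>U i\<close> a class has exactly one entry with index
      \<open>i\<close>, so the description in the glued trivialization returns the coordinate in the
      \<open>i\<close>-th encoder.\<close>
    moreover have "snd t' (ae_class I A (x, v)) = tangent_map (U i) (E i) x v" if "x \<in> U i" for x v
      using i that by (simp add: t' mem_ae_class_iff)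
    ultimately show ?thesis
      by (intro bexI[of _ "(U i, \<lambda>(x, v). tangent_map (U i) (E i) x v)"])
        (auto simp: t' b_over_tangent_bundle[OF dom_subset])
  qed
qed

end

theorem proposition3p14:
  fixes M :: "(real ^ 'N) set"
    and I :: "'i set"
    and A :: "'i \<Rightarrow> (real ^ 'N, real ^ 'd) ae_chart"
  assumes "compact M"
    and "smooth_submanifold TYPE(real ^ 'd) M"
    and "smooth_ae_atlas M I A"
    and "smooth_atlas M ((\<lambda>i. (ae_dom (A i), ae_enc (A i))) ` I)"
    and "compatible_with_smooth_structure M ((\<lambda>i. (ae_dom (A i), ae_enc (A i))) ` I)"
  shows "isomorphic_vector_bundles M (ae_tangent_bundle I A)
           (tangent_bundle M :: ((real ^ 'N) \<times> (real ^ 'N), real ^ 'N, real ^ 'd) vbundle)"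
proof -
  \<comment> \<open>The clause on charts in \<open>smooth_atlas\<close> supplies the openness of the
    encoder images.\<close>
  interpret ae_atlas M I A
    using assms(3,4) by unfold_locales (auto simp: smooth_atlas_def)
  show ?thesis
    by (rule isomorphic_ae_tangent_bundle[OF assms(2)])
qed

end
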